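(* For every $n\in\mathbb{Z}_{>0}$ the following identities hold in the quantum cluster algebra $\mathcal{A}_q(Q)$ of type $A_2^{(1)}$ with principal coefficients: (1) $X_{2n+3}=\sum_{l=0}^{\lfloor n/2\rfloor}q^{\frac{5l}{2}}u_{n-2l}X_3(y_1y_2y_3)^l-\sum_{l=0}^{\lfloor (n-1)/2\rfloor}q^{\frac{5(l+1)}{2}}u_{n-1-2l}X_1(y_1y_2y_3)^{l+1}$; (2) $X_{2n+4}=\sum_{l=0}^{\lfloor n/2\rfloor}q^{\frac{5l}{2}}u_{n-2l}X_4(y_1y_2y_3)^l-\sum_{l=0}^{\lfloor (n-1)/2\rfloor}q^{\frac{5(l+1)}{2}}u_{n-1-2l}X_2(y_1y_2y_3)^{l+1}$; (3) $X_{-2n}=\sum_{l=0}^{\lfloor n/2\rfloor}q^{\frac{l}{2}}u_{n-2l}X_0(y_1y_2y_3)^l-\sum_{l=0}^{\lfloor (n-1)/2\rfloor}q^{\frac{l-1}{2}}u_{n-1-2l}X_2y_3(y_1y_2y_3)^{l}$; (4) $X_{-(2n+1)}=\sum_{l=0}^{\lfloor n/2\rfloor}q^{\frac{l}{2}}u_{n-2l}X_{-1}(y_1y_2y_3)^l-\sum_{l=0}^{\lfloor (n-1)/2\rfloor}q^{\frac{l}{2}}u_{n-1-2l}X_1y_2y_3(y_1y_2y_3)^{l}$.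
   Context: Quantum torus. Let $q$ be a formal parameter and let $\Lambda$ be the skew-symmetric bilinear form on $\mathbb{Z}^6$ (standard basis $\mathbf e_1,\dots,\mathbf e_6$) with $\Lambda(\mathbf e_i,\mathbf e_j)=\lambda_{ij}$, where $$(\lambda_{ij})=\begin{pmatrix}0&0&0&-1&0&0\\0&0&0&0&-1&0\\0&0&0&0&0&-1\\1&0&0&0&-1&-1\\0&1&0&1&0&-1\\0&0&1&1&1&0\end{pmatrix},\qquad \widetilde B=\begin{pmatrix}0&1&1\\-1&0&1\\-1&-1&0\\1&0&0\\0&1&0\\0&0&1\end{pmatrix}.$$ The based quantum torus $\mathcal T$ is the $\mathbb{Z}[q^{\pm 1/2}]$-algebra with $\mathbb{Z}[q^{\pm 1/2}]$-basis $\{X^{\mathbf c}:\mathbf c\in\mathbb{Z}^6\}$ and multiplication $X^{\mathbf c}X^{\mathbf d}=q^{\Lambda(\mathbf c,\mathbf d)/2}X^{\mathbf c+\mathbf d}$; $\mathcal F$ is its skew-field of fractions. Put $X_i=X^{\mathbf e_i}$ for $i=1,2,3$ and $y_1=X^{\mathbf e_4}$, $y_2=X^{\mathbf e_5}$, $y_3=X^{\mathbf e_6}$ (these do not commute; products are ordered as written). Seeds and mutation. A quantum seed is a triple $(\Lambda',\widetilde B',X')$ with $X'=(X_1',\dots,X_6')$ in $\mathcal F$, where $(X')^{\mathbf c}:=q^{-\frac12\sum_{i<j}c_ic_j\lambda'_{ij}}(X_1')^{c_1}\cdots (X_6')^{c_6}$. The mutation in direction $k\in\{1,2,3\}$ replaces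 $\Lambda'$ by $E^T\Lambda' E$, where $E=(e_{ij})$ has $e_{ij}=\delta_{ij}$ for $j\ne k$, $e_{kk}=-1$, $e_{ik}=[-b'_{ik}]_+$ for $i\ne k$ ($[a]_+=\max(a,0)$); replaces $b'_{ij}$ by $-b'_{ij}$ if $i=k$ or $j=k$, and by $b'_{ij}+\frac12(|b'_{ik}|b'_{kj}+b'_{ik}|b'_{kj}|)$ otherwise; and replaces $X'_k$ by $(X')^{-\mathbf e_k+\sum_i[b'_{ik}]_+\mathbf e_i}+(X')^{-\mathbf e_k+\sum_i[-b'_{ik}]_+\mathbf e_i}$, leaving the other $X'_j$ unchanged. The initial seed is $\Sigma_1=(\Lambda,\widetilde B,(X_1,X_2,X_3,y_1,y_2,y_3))$; $\mathcal A_q(Q)\subset\mathcal F$ is generated, over Laurent polynomials in $y_1,y_2,y_3$ with coefficients in $\mathbb{Z}[q^{\pm1/2}]$, by all quantum cluster variables (first three entries of $X'$ in seeds obtained from $\Sigma_1$ by finitely many mutations). Variables $X_m$, $m\in\mathbb{Z}$. The seed $\Sigma_m$ has cluster $(X_m,X_{m+1},X_{m+2})$: mutating $\Sigma_m$ in direction 1 replaces $X_m$ by $X_{m+3}$ and, after reordering the first three indices to $(X_{m+1},X_{m+2},X_{m+3})$, gives $\Sigma_{m+1}$; mutating $\Sigma_m$ in direction 3 replaces $X_{m+2}$ by $X_{m-1}$ and, after reordering to $(X_{m-1},X_m,X_{m+1})$, gives $\Sigma_{m-1}$. Elements $w,z,u_n$: $w=X^{(1,-1,0,0,1,0)}+X^{(0,-1,1,0,0,0)}$,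 $z=X^{(0,1,-1,1,0,1)}+X^{(-1,0,-1,1,0,0)}+X^{(-1,1,0,0,0,0)}$; $u_0=1$, $u_1=wz-q^{-1/2}X^{(0,0,0,1,0,1)}-q^{1/2}X^{(0,0,0,0,1,0)}$, $u_2=u_1^2-2X^{(0,0,0,1,1,1)}$, $u_{n+1}=u_1u_n-X^{(0,0,0,1,1,1)}u_{n-1}$ for $n\ge2$. *)

theory Defs
  imports "HOL-Library.Poly_Mapping" "HOL-Library.Product_Plus"
begin

section \<open>The based quantum torus\<close>

text \<open>
  A coefficient in $\mathbb{Z}[q^{\pm 1/2}]$ is an element of the group ring of the integers:
  the basis element at key \<open>a\<close> is $q^{a/2}$, and the product is the convolution product
  of \<^type>\<open>poly_mapping\<close>.
\<close>

type_synonym qlaurent = "int \<Rightarrow>\<^sub>0 int"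

type_synonym expo = "int \<times> int \<times> int \<times> int \<times> int \<times> int"

text \<open>Vector and matrix indices run from 1 as usual; list positions run from 0.\<close>

definition coord :: "expo \<Rightarrow> nat \<Rightarrow> int" where
  "coord c i = (case c of (c1, c2, c3, c4, c5, c6) \<Rightarrow> [c1, c2, c3, c4, c5, c6] ! (i - 1))"

definition unit_expo :: "nat \<Rightarrow> expo" where
  "unit_expo i = (of_bool (i = 1), of_bool (i = 2), of_bool (i = 3),
                  of_bool (i = 4), of_bool (i = 5), of_bool (i = 6))"

definition lam0 :: "nat \<Rightarrow> nat \<Rightarrow> int" where
  "lam0 i j =
    [[0, 0, 0, -1,  0,  0],
     [0, 0, 0,  0, -1,  0],
     [0, 0, 0,  0,  0, -1],
     [1, 0, 0,  0, -1, -1],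
     [0, 1, 0,  1,  0, -1],
     [0, 0, 1,  1,  1,  0]] ! (i - 1) ! (j - 1)"

definition B0 :: "nat \<Rightarrow> nat \<Rightarrow> int" where
  "B0 i j =
    [[ 0,  1, 1],
     [-1,  0, 1],
     [-1, -1, 0],
     [ 1,  0, 0],
     [ 0,  1, 0],
     [ 0,  0, 1]] ! (i - 1) ! (j - 1)"

definition Lambda :: "expo \<Rightarrow> expo \<Rightarrow> int" where
  "Lambda c d = (\<Sum>i\<in>{1..6}. \<Sum>j\<in>{1..6}. coord c i * lam0 i j * coord d j)"

lemma coord_add: "i \<in> {1..6} \<Longrightarrow> coord (c + d) i = coord c i + coord d i"
proof -
  assume "i \<in> {1..6}"
  then have "i - 1 = 0 \<or> i - 1 = 1 \<or> i - 1 = 2 \<or> i - 1 = 3 \<or> i - 1 = 4 \<or> i - 1 = 5"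
    by auto
  then show ?thesis
    by (cases c; cases d) (auto simp: coord_def)
qed

lemma Lambda_add_left: "Lambda (c + c') d = Lambda c d + Lambda c' d"
  unfolding Lambda_def sum.distrib[symmetric]
  by (intro sum.cong refl) (simp add: coord_add algebra_simps)

lemma Lambda_add_right: "Lambda c (d + d') = Lambda c d + Lambda c d'"
  unfolding Lambda_def sum.distrib[symmetric]
  by (intro sum.cong refl) (simp add: coord_add algebra_simps)

lemma Lambda_zero_left [simp]: "Lambda 0 d = 0"
  using Lambda_add_left[of 0 0 d] by simp

lemma Lambda_zero_right [simp]: "Lambda c 0 = 0"
  using Lambda_add_right[of c 0 0] by simp

text \<open>\<open>qp a\<close> is $q^{a/2}$.\<close>

definition qp :: "int \<Rightarrow> qlaurent" where
  "qp a = Poly_Mapping.single a 1"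

lemma qp_0 [simp]: "qp 0 = 1"
  by (simp add: qp_def)

lemma qp_add: "qp (a + b) = qp a * qp b"
  by (simp add: qp_def mult_single)

text \<open>
  The product determined by bilinearity over the (commutative) coefficients and
  $X^c X^d = q^{\Lambda(c,d)/2} X^{c+d}$.
\<close>

definition twist :: "(expo \<Rightarrow>\<^sub>0 qlaurent) \<Rightarrow> (expo \<Rightarrow>\<^sub>0 qlaurent) \<Rightarrow> (expo \<Rightarrow>\<^sub>0 qlaurent)" where
  "twist f g = (\<Sum>c\<in>Poly_Mapping.keys f. \<Sum>d\<in>Poly_Mapping.keys g.
      Poly_Mapping.single (c + d)
        (Poly_Mapping.lookup f c * Poly_Mapping.lookup g d * qp (Lambda c d)))"

lemma twist_superset:
  assumes "finite A" "Poly_Mapping.keys f \<subseteq> A" "finite B" "Poly_Mapping.keys g \<subseteq> B"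
  shows "twist f g = (\<Sum>c\<in>A. \<Sum>d\<in>B. Poly_Mapping.single (c + d)
           (Poly_Mapping.lookup f c * Poly_Mapping.lookup g d * qp (Lambda c d)))"
proof -
  have "twist f g = (\<Sum>c\<in>Poly_Mapping.keys f. \<Sum>d\<in>B. Poly_Mapping.single (c + d)
           (Poly_Mapping.lookup f c * Poly_Mapping.lookup g d * qp (Lambda c d)))"
    unfolding twist_def using assms
    by (intro sum.cong refl sum.mono_neutral_left) (auto simp: in_keys_iff)
  also have "\<dots> = (\<Sum>c\<in>A. \<Sum>d\<in>B. Poly_Mapping.single (c + d)
           (Poly_Mapping.lookup f c * Poly_Mapping.lookup g d * qp (Lambda c d)))"
    using assms by (intro sum.mono_neutral_left) (auto simp: in_keys_iff)
  finally show ?thesis .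
qed

lemma twist_add_left: "twist (f + f') g = twist f g + twist f' g"
proof -
  let ?A = "Poly_Mapping.keys f \<union> Poly_Mapping.keys f'"
  have "Poly_Mapping.keys (f + f') \<subseteq> ?A"
    by (rule Poly_Mapping.keys_add)
  then show ?thesis
    by (subst (1 2 3) twist_superset[where A = ?A and B = "Poly_Mapping.keys g"])
       (auto simp: lookup_add algebra_simps single_add sum.distrib)
qed

lemma twist_add_right: "twist f (g + g') = twist f g + twist f g'"
proof -
  let ?B = "Poly_Mapping.keys g \<union> Poly_Mapping.keys g'"
  have "Poly_Mapping.keys (g + g') \<subseteq> ?B"
    by (rule Poly_Mapping.keys_add)
  then show ?thesis
    by (subst (1 2 3) twist_superset[where B = ?B and A = "Poly_Mapping.keys f"])
       (auto simp: lookup_add algebra_simps single_add sum.distrib)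
qed

lemma twist_zero_left [simp]: "twist 0 g = 0"
  by (simp add: twist_def)

lemma twist_zero_right [simp]: "twist f 0 = 0"
  by (simp add: twist_def)

lemma twist_single:
  "twist (Poly_Mapping.single c a) (Poly_Mapping.single d b)
     = Poly_Mapping.single (c + d) (a * b * qp (Lambda c d))"
  by (subst twist_superset[where A = "{c}" and B = "{d}"]) auto

lemma poly_mapping_additive_induct:
  fixes f :: "expo \<Rightarrow>\<^sub>0 qlaurent"
  assumes "P 0" "\<And>c a. P (Poly_Mapping.single c a)" "\<And>f g. P f \<Longrightarrow> P g \<Longrightarrow> P (f + g)"
  shows "P f"
proof (induction f rule: update_induct)
  case const
  then show ?case using assms(1) by simp
next
  case (update f c a)
  have "Poly_Mapping.update c a f = f + Poly_Mapping.single c a"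
    using update.hyps
    by (intro poly_mapping_eqI) (auto simp: lookup_update lookup_add lookup_single when_def in_keys_iff)
  then show ?case using assms(2,3) update.IH by simp
qed

lemma twist_assoc: "twist (twist f g) h = twist f (twist g h)"
proof (induction f rule: poly_mapping_additive_induct)
  case (2 c a)
  show ?case
  proof (induction g rule: poly_mapping_additive_induct)
    case (2 d b)
    show ?case
    proof (induction h rule: poly_mapping_additive_induct)
      case (2 e r)
      then show ?case
        by (simp add: twist_single Lambda_add_left Lambda_add_right qp_add mult_ac add_ac)
    qed (simp_all add: twist_add_right)
  qed (simp_all add: twist_add_left twist_add_right)
qed (simp_all add: twist_add_left)

lemma twist_one_left: "twist (Poly_Mapping.single 0 1) g = g"
  by (induction g rule: poly_mapping_additive_induct) (simp_all add: twist_single twist_add_right del: single_one)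

lemma twist_one_right: "twist f (Poly_Mapping.single 0 1) = f"
  by (induction f rule: poly_mapping_additive_induct) (simp_all add: twist_single twist_add_left del: single_one)

typedef qtorus = "UNIV :: (expo \<Rightarrow>\<^sub>0 qlaurent) set"
  morphisms coeffs of_coeffs ..

setup_lifting type_definition_qtorus

instantiation qtorus :: ring_1
begin

lift_definition zero_qtorus :: qtorus is 0 .
lift_definition one_qtorus :: qtorus is "Poly_Mapping.single 0 1" .
lift_definition plus_qtorus :: "qtorus \<Rightarrow> qtorus \<Rightarrow> qtorus" is plus .
lift_definition minus_qtorus :: "qtorus \<Rightarrow> qtorus \<Rightarrow> qtorus" is minus .
lift_definition uminus_qtorus :: "qtorus \<Rightarrow> qtorus" is uminus .
lift_definition times_qtorus :: "qtorus \<Rightarrow> qtorus \<Rightarrow> qtorus" is twist .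

instance
proof
  fix a b c :: qtorus
  show "a + b + c = a + (b + c)" by transfer (simp add: add_ac)
  show "a + b = b + a" by transfer (simp add: add_ac)
  show "0 + a = a" by transfer simp
  show "- a + a = 0" by transfer simp
  show "a - b = a + - b" by transfer simp
  show "a * b * c = a * (b * c)" by transfer (rule twist_assoc)
  show "(a + b) * c = a * c + b * c" by transfer (rule twist_add_left)
  show "a * (b + c) = a * b + a * c" by transfer (rule twist_add_right)
  show "1 * a = a" by transfer (rule twist_one_left)
  show "a * 1 = a" by transfer (rule twist_one_right)
  show "(0::qtorus) \<noteq> 1"
  proof transfer
    show "(0 :: expo \<Rightarrow>\<^sub>0 qlaurent) \<noteq> Poly_Mapping.single 0 1"
      by (metis lookup_single_eq lookup_zero zero_neq_one)
  qed
qed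

end

text \<open>The basis element $X^c$, and the scalar $q^{a/2}$ as an element of the torus.\<close>

lift_definition XX :: "expo \<Rightarrow> qtorus" is "\<lambda>c. Poly_Mapping.single c 1" .

lift_definition qh :: "int \<Rightarrow> qtorus" is "\<lambda>a. Poly_Mapping.single 0 (qp a)" .

lemma XX_mult: "XX c * XX d = qh (Lambda c d) * XX (c + d)"
  by transfer (simp add: twist_single)

lemma qh_0: "qh 0 = 1"
  by transfer simp

lemma qh_add: "qh (a + b) = qh a * qh b"
  by transfer (simp add: twist_single qp_add)

lemma qh_central: "qh a * t = t * qh a"
proof transfer
  fix a :: int and t :: "expo \<Rightarrow>\<^sub>0 qlaurent"
  show "twist (Poly_Mapping.single 0 (qp a)) t = twist t (Poly_Mapping.single 0 (qp a))"
    by (induction t rule: poly_mapping_additive_induct)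
       (simp_all add: twist_single twist_add_left twist_add_right mult_ac)
qed


section \<open>The skew-field of fractions\<close>

text \<open>
  The quantum torus is an Ore domain, so its skew-field of fractions exists and is unique up to a
  unique isomorphism over the torus. It is represented by any division ring together with an
  embedding of the torus such that every element is a fraction.
\<close>

definition skew_field_of_fractions :: "(qtorus \<Rightarrow> 'f::division_ring) \<Rightarrow> bool" where
  "skew_field_of_fractions \<iota> \<longleftrightarrow>
     \<iota> 1 = 1 \<and> (\<forall>s t. \<iota> (s + t) = \<iota> s + \<iota> t) \<and> (\<forall>s t. \<iota> (s * t) = \<iota> s * \<iota> t) \<and>
     inj \<iota> \<and> (\<forall>x. \<exists>s t. t \<noteq> 0 \<and> x = \<iota> s * inverse (\<iota> t))"


section \<open>Quantum seeds and mutation\<close>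

text \<open>
  Only the entries of \<open>form\<close> with both indices in \<open>{1..6}\<close>, those of \<open>bmat\<close> with row in \<open>{1..6}\<close>
  and column in \<open>{1..3}\<close>, and those of \<open>vars\<close> with index in \<open>{1..6}\<close> are meaningful.
\<close>

record 'f quantum_seed =
  form :: "nat \<Rightarrow> nat \<Rightarrow> int"
  bmat :: "nat \<Rightarrow> nat \<Rightarrow> int"
  vars :: "nat \<Rightarrow> 'f"

definition seed_monomial ::
  "(qtorus \<Rightarrow> 'f::division_ring) \<Rightarrow> 'f quantum_seed \<Rightarrow> (nat \<Rightarrow> int) \<Rightarrow> 'f" where
  "seed_monomial \<iota> S c =
     \<iota> (qh (- (\<Sum>i\<in>{1..6}. \<Sum>j\<in>{i<..6}. c i * c j * form S i j))) *
     prod_list (map (\<lambda>i. vars S i powi c i) [1..<7])"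

definition mutation_matrix :: "(nat \<Rightarrow> nat \<Rightarrow> int) \<Rightarrow> nat \<Rightarrow> nat \<Rightarrow> nat \<Rightarrow> int" where
  "mutation_matrix b k i j =
     (if j \<noteq> k then of_bool (i = j) else if i = k then -1 else max (- b i k) 0)"

definition mutate_form ::
  "(nat \<Rightarrow> nat \<Rightarrow> int) \<Rightarrow> (nat \<Rightarrow> nat \<Rightarrow> int) \<Rightarrow> nat \<Rightarrow> nat \<Rightarrow> nat \<Rightarrow> int" where
  "mutate_form L b k i j =
     (\<Sum>r\<in>{1..6}. \<Sum>s\<in>{1..6}. mutation_matrix b k r i * L r s * mutation_matrix b k s j)"

text \<open>The dividend below is always even, so the integer division is exact.\<close>

definition mutate_bmat :: "(nat \<Rightarrow> nat \<Rightarrow> int) \<Rightarrow> nat \<Rightarrow> nat \<Rightarrow> nat \<Rightarrow> int" where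
  "mutate_bmat b k i j =
     (if i = k \<or> j = k then - b i j
      else b i j + (\<bar>b i k\<bar> * b k j + b i k * \<bar>b k j\<bar>) div 2)"

definition mutate ::
  "(qtorus \<Rightarrow> 'f::division_ring) \<Rightarrow> nat \<Rightarrow> 'f quantum_seed \<Rightarrow> 'f quantum_seed" where
  "mutate \<iota> k S =
     \<lparr> form = mutate_form (form S) (bmat S) k,
       bmat = mutate_bmat (bmat S) k,
       vars = (vars S)(k :=
         seed_monomial \<iota> S (\<lambda>i. - of_bool (i = k) + max (bmat S i k) 0) +
         seed_monomial \<iota> S (\<lambda>i. - of_bool (i = k) + max (- bmat S i k) 0)) \<rparr>"

definition initial_seed :: "(qtorus \<Rightarrow> 'f::division_ring) \<Rightarrow> 'f quantum_seed" where
  "initial_seed \<iota> = \<lparr> form = lam0, bmat = B0, vars = (\<lambda>i. \<iota> (XX (unit_expo i))) \<rparr>"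

inductive_set reachable_seeds :: "(qtorus \<Rightarrow> 'f::division_ring) \<Rightarrow> 'f quantum_seed set"
  for \<iota> :: "qtorus \<Rightarrow> 'f" where
  initial: "initial_seed \<iota> \<in> reachable_seeds \<iota>"
| mutation: "S \<in> reachable_seeds \<iota> \<Longrightarrow> k \<in> {1, 2, 3} \<Longrightarrow> mutate \<iota> k S \<in> reachable_seeds \<iota>"

text \<open>
  The subring generated by $q^{a/2}$, the Laurent monomials in $y_1, y_2, y_3$ and the quantum
  cluster variables.
\<close>

inductive_set quantum_cluster_algebra :: "(qtorus \<Rightarrow> 'f::division_ring) \<Rightarrow> 'f set"
  for \<iota> :: "qtorus \<Rightarrow> 'f" where
  scalar: "\<iota> (qh a) \<in> quantum_cluster_algebra \<iota>"
| frozen: "\<iota> (XX (0, 0, 0, a, b, c)) \<in> quantum_cluster_algebra \<iota>"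
| cluster_variable:
    "S \<in> reachable_seeds \<iota> \<Longrightarrow> i \<in> {1, 2, 3} \<Longrightarrow> vars S i \<in> quantum_cluster_algebra \<iota>"
| diff: "x \<in> quantum_cluster_algebra \<iota> \<Longrightarrow> y \<in> quantum_cluster_algebra \<iota> \<Longrightarrow>
    x - y \<in> quantum_cluster_algebra \<iota>"
| mult: "x \<in> quantum_cluster_algebra \<iota> \<Longrightarrow> y \<in> quantum_cluster_algebra \<iota> \<Longrightarrow>
    x * y \<in> quantum_cluster_algebra \<iota>"


section \<open>The seeds \<open>\<Sigma>\<^sub>m\<close> and the variables \<open>X\<^sub>m\<close>\<close>

definition reorder :: "(nat \<Rightarrow> nat) \<Rightarrow> 'f quantum_seed \<Rightarrow> 'f quantum_seed" where
  "reorder p S =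
     \<lparr> form = (\<lambda>i j. form S (p i) (p j)),
       bmat = (\<lambda>i j. bmat S (p i) (p j)),
       vars = (\<lambda>i. vars S (p i)) \<rparr>"

text \<open>
  Mutation of $(X_m, X_{m+1}, X_{m+2})$ in direction 1 gives $(X_{m+3}, X_{m+1}, X_{m+2})$, and in
  direction 3 gives $(X_m, X_{m+1}, X_{m-1})$; the reorderings put these in increasing order.
\<close>

definition next_seed :: "(qtorus \<Rightarrow> 'f::division_ring) \<Rightarrow> 'f quantum_seed \<Rightarrow> 'f quantum_seed" where
  "next_seed \<iota> S = reorder (id(1 := 2, 2 := 3, 3 := 1)) (mutate \<iota> 1 S)"

definition prev_seed :: "(qtorus \<Rightarrow> 'f::division_ring) \<Rightarrow> 'f quantum_seed \<Rightarrow> 'f quantum_seed" where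
  "prev_seed \<iota> S = reorder (id(1 := 3, 2 := 1, 3 := 2)) (mutate \<iota> 3 S)"

definition Sigma_seed :: "(qtorus \<Rightarrow> 'f::division_ring) \<Rightarrow> int \<Rightarrow> 'f quantum_seed" where
  "Sigma_seed \<iota> m =
     (if m \<ge> 1 then (next_seed \<iota> ^^ nat (m - 1)) (initial_seed \<iota>)
      else (prev_seed \<iota> ^^ nat (1 - m)) (initial_seed \<iota>))"

definition Xvar :: "(qtorus \<Rightarrow> 'f::division_ring) \<Rightarrow> int \<Rightarrow> 'f" where
  "Xvar \<iota> m = vars (Sigma_seed \<iota> m) 1"

definition yvar :: "(qtorus \<Rightarrow> 'f::division_ring) \<Rightarrow> nat \<Rightarrow> 'f" where
  "yvar \<iota> i = \<iota> (XX (unit_expo (3 + i)))"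


section \<open>The elements \<open>w\<close>, \<open>z\<close>, \<open>u\<^sub>n\<close>\<close>

definition w_elt :: qtorus where
  "w_elt = XX (1, -1, 0, 0, 1, 0) + XX (0, -1, 1, 0, 0, 0)"

definition z_elt :: qtorus where
  "z_elt = XX (0, 1, -1, 1, 0, 1) + XX (-1, 0, -1, 1, 0, 0) + XX (-1, 1, 0, 0, 0, 0)"

definition u1_elt :: qtorus where
  "u1_elt = w_elt * z_elt - qh (-1) * XX (0, 0, 0, 1, 0, 1) - qh 1 * XX (0, 0, 0, 0, 1, 0)"

fun u_elt :: "nat \<Rightarrow> qtorus" where
  "u_elt 0 = 1"
| "u_elt (Suc 0) = u1_elt"
| "u_elt (Suc (Suc 0)) = u1_elt ^ 2 - 2 * XX (0, 0, 0, 1, 1, 1)"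
| "u_elt (Suc (Suc (Suc n))) =
     u1_elt * u_elt (Suc (Suc n)) - XX (0, 0, 0, 1, 1, 1) * u_elt (Suc n)"

end

(*
  Idea. Write D = X^(0,0,0,1,1,1). Each of the sequences X_(2n+1), X_(2n+2), X_(-2n), X_(-2n-1)
  satisfies c_(n+2) = u_1 c_(n+1) - D c_n. The recursion also holds with the factors u_1 and D on
  the right. Using the right-hand version for a sequence a and the left-hand one for a sequence b,
  the expression a_n b_(n+1) - a_(n+1) b_n is multiplied by a power of q times D in each step. So it
  is a frozen monomial, and comparison with the c-vectors of the seeds shows that these relations
  are exactly the exchange relations. By induction the seeds Sigma_m are therefore made of the
  entries of the four sequences. The elements of a cluster commute: this passes from one cluster to
  the next by cancelling in the exchange relation inside the skew-field.

  The closed formulas follow because S_n, the sum of the u_(n-2l) D^l, satisfies the same recursion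
  with S_0 = 1 and S_1 = u_1. The powers of q come from moving D past the frozen and cluster
  variables. Membership in the cluster algebra reduces to u_1, and w and z are themselves cluster
  variables, reached by the mutations 2 and 1, 3.
*)
theory Submission
  imports Defs
begin

section \<open>Explicit evaluation of the form\<close>

lemma sum_1_6:
  "(\<Sum>i\<in>{1..6::nat}. f i) = f 1 + (f 2 + (f 3 + (f 4 + (f 5 + f 6))))"
proof -
  have *: "{1..6} = insert 1 (insert 2 (insert 3 (insert 4 (insert 5 {6::nat}))))" by auto
  show ?thesis
    by (subst *, (subst sum.insert, simp, simp)+) simp
qed

lemma coord_eval:
  "coord (c1, c2, c3, c4, c5, c6) 1 = c1" "coord (c1, c2, c3, c4, c5, c6) 2 = c2"
  "coord (c1, c2, c3, c4, c5, c6) 3 = c3" "coord (c1, c2, c3, c4, c5, c6) 4 = c4"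
  "coord (c1, c2, c3, c4, c5, c6) 5 = c5" "coord (c1, c2, c3, c4, c5, c6) 6 = c6"
  by (simp_all add: coord_def)

lemma Lambda_eval:
  "Lambda (c1, c2, c3, c4, c5, c6) (d1, d2, d3, d4, d5, d6) =
     c4 * d1 - c1 * d4 + c5 * d2 - c2 * d5 + c6 * d3 - c3 * d6 +
     c5 * d4 - c4 * d5 + c6 * d4 - c4 * d6 + c6 * d5 - c5 * d6"
  unfolding Lambda_def sum_1_6 coord_eval
  by (simp add: lam0_def del: One_nat_def)

section \<open>Calculus of monomials\<close>

text \<open>Products of such elements have the same shape (\<open>monom_mult\<close>), so identities
  between explicit torus elements reduce to integer arithmetic on exponents.\<close>

definition monom :: "int \<Rightarrow> expo \<Rightarrow> qtorus" where
  "monom a c = qh a * XX c"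

lemma qh_left_commute: "f * (qh a * g) = qh a * (f * g)"
  by (simp add: mult.assoc[symmetric] qh_central[of a f])

lemma monom_mult: "monom a c * monom b d = monom (a + b + Lambda c d) (c + d)"
proof -
  have "monom a c * monom b d = qh a * (XX c * qh b) * XX d"
    by (simp add: monom_def mult.assoc)
  also have "\<dots> = qh a * qh b * (XX c * XX d)"
    by (simp add: mult.assoc qh_left_commute[of "XX c"])
  finally show ?thesis
    by (simp add: monom_def XX_mult qh_add mult.assoc)
qed

lemma XX_monom: "XX c = monom 0 c"
  by (simp add: monom_def qh_0)

lemma XX_zero: "XX 0 = 1"
  by transfer simp

lemma qh_monom: "qh a = monom a (0, 0, 0, 0, 0, 0)"
  using XX_zero by (simp add: monom_def zero_prod_def)

lemma one_monom: "1 = monom 0 (0, 0, 0, 0, 0, 0)"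
  using qh_monom[of 0] by (simp add: qh_0)

abbreviation ymon :: "int \<Rightarrow> int \<Rightarrow> int \<Rightarrow> qtorus" where
  "ymon a b c \<equiv> XX (0, 0, 0, a, b, c)"

abbreviation dlt :: qtorus where
  "dlt \<equiv> ymon 1 1 1"

text \<open>Of the six terms of \<open>w_elt * z_elt\<close>, two are frozen monomials with factors
  q^(1/2) and q^(-1/2); these are the ones that \<open>u1_elt_def\<close> subtracts.\<close>

lemma u1_elt_eval:
  "u1_elt = monom 0 (1, 0, -1, 1, 1, 1) + monom 0 (0, -1, -1, 1, 1, 0) +
     monom 0 (-1, -1, 0, 1, 0, 0) + monom 0 (-1, 0, 1, 0, 0, 0)"
  unfolding u1_elt_def w_elt_def z_elt_def XX_monom qh_monom
  by (simp add: distrib_left distrib_right monom_mult Lambda_eval)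

lemmas torus_eval = XX_monom qh_monom distrib_left distrib_right
  left_diff_distrib right_diff_distrib monom_mult Lambda_eval

section \<open>Homogeneity with respect to the frozen variables\<close>

text \<open>The d_i are the exponents in f y_i = q^(d_i) y_i f; the factor 2 appears because
  \<open>qh a\<close> is q^(a/2).\<close>

definition y_degree :: "qtorus \<Rightarrow> int \<Rightarrow> int \<Rightarrow> int \<Rightarrow> bool" where
  "y_degree f d1 d2 d3 \<longleftrightarrow>
     (\<forall>a b c. f * ymon a b c = qh (2 * (d1 * a + d2 * b + d3 * c)) * (ymon a b c * f))"

text \<open>The three numbers are Lambda(c, e_4), Lambda(c, e_5) and Lambda(c, e_6): exchanging two
  basis elements costs q to the power Lambda.\<close>

lemma y_degree_monom:
  assumes "d1 = c5 + c6 - c1" "d2 = c6 - c2 - c4" "d3 = - c3 - c4 - c5"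
  shows "y_degree (monom e (c1, c2, c3, c4, c5, c6)) d1 d2 d3"
  unfolding y_degree_def assms by (simp add: torus_eval add_ac) (simp add: algebra_simps)

lemma y_degree_XX:
  assumes "d1 = c5 + c6 - c1" "d2 = c6 - c2 - c4" "d3 = - c3 - c4 - c5"
  shows "y_degree (XX (c1, c2, c3, c4, c5, c6)) d1 d2 d3"
  unfolding XX_monom by (rule y_degree_monom) fact+

lemma y_degree_add: "y_degree f a b c \<Longrightarrow> y_degree g a b c \<Longrightarrow> y_degree (f + g) a b c"
  by (simp add: y_degree_def distrib_left distrib_right)

lemma y_degree_diff: "y_degree f a b c \<Longrightarrow> y_degree g a b c \<Longrightarrow> y_degree (f - g) a b c"
  by (simp add: y_degree_def left_diff_distrib right_diff_distrib)

lemma y_degree_mult: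
  assumes f: "y_degree f a b c" and g: "y_degree g a' b' c'"
  shows "y_degree (f * g) (a + a') (b + b') (c + c')"
  unfolding y_degree_def
proof (intro allI)
  fix i j k :: int
  let ?y = "ymon i j k" and ?d = "2 * (a * i + b * j + c * k)" and ?d' = "2 * (a' * i + b' * j + c' * k)"
  have "f * g * ?y = f * (qh ?d' * (?y * g))"
    using g by (simp add: y_degree_def mult.assoc)
  also have "\<dots> = qh ?d' * (f * ?y) * g"
    using f by (simp add: qh_left_commute[of f] mult.assoc)
  also have "\<dots> = (qh ?d' * qh ?d) * (?y * (f * g))"
    using f by (simp add: y_degree_def mult.assoc)
  also have "qh ?d' * qh ?d = qh (2 * ((a + a') * i + (b + b') * j + (c + c') * k))"
    by (simp add: qh_add[symmetric] algebra_simps)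
  finally show "f * g * ?y = qh (2 * ((a + a') * i + (b + b') * j + (c + c') * k)) * (?y * (f * g))" .
qed

lemma y_degree_u1: "y_degree u1_elt 1 0 (-1)"
  unfolding u1_elt_eval by (intro y_degree_add y_degree_monom) simp_all

lemma y_degree_commute:
  assumes "y_degree f d1 d2 d3" "d1 * a + d2 * b + d3 * c = 0"
  shows "f * (qh e * ymon a b c) = qh e * ymon a b c * f"
proof -
  have "f * ymon a b c = ymon a b c * f"
    using assms(1) unfolding y_degree_def by (simp only: assms(2) mult_zero_right qh_0 mult_1_left)
  then show ?thesis
    by (simp add: qh_left_commute[of f] mult.assoc)
qed

text \<open>The degree (1, 0, -1) of \<open>u1_elt\<close> has coordinate sum 0, and this sum is the
  power of q picked up in passing \<open>dlt\<close>.\<close>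

lemma u1_dlt: "u1_elt * dlt = dlt * u1_elt"
  using y_degree_commute[OF y_degree_u1, of 1 1 1 0] by (simp add: qh_0)

section \<open>Sequences with the recursion of the cluster variables\<close>

text \<open>The starting values are free: four choices give the sequences of cluster variables, and
  1, \<open>u1_elt\<close> give the sums S_n.\<close>

fun chain :: "qtorus \<Rightarrow> qtorus \<Rightarrow> nat \<Rightarrow> qtorus" where
  "chain x y 0 = x"
| "chain x y (Suc 0) = y"
| "chain x y (Suc (Suc n)) = u1_elt * chain x y (Suc n) - dlt * chain x y n"

lemma chain_shift: "chain y (u1_elt * y - dlt * x) n = chain x y (Suc n)"
  by (induction n rule: induct_nat_012) simp_all

text \<open>Left and right multiplications commute, so the defect between the two recursions itself
  satisfies the left recursion. It vanishes once its first two values do, and these are the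
  hypotheses.\<close>

lemma chain_right:
  assumes "u1_elt * y - dlt * x = y * u1_elt - x * dlt"
    and "u1_elt * (u1_elt * y - dlt * x) - dlt * y = (u1_elt * y - dlt * x) * u1_elt - y * dlt"
  shows "chain x y (Suc (Suc n)) = chain x y (Suc n) * u1_elt - chain x y n * dlt"
proof (induction n rule: induct_nat_012)
  case (ge2 n)
  let ?c = "chain x y"
  have "?c (Suc (Suc (Suc (Suc n)))) = u1_elt * ?c (Suc (Suc (Suc n))) - dlt * ?c (Suc (Suc n))"
    by simp
  also have "\<dots> = u1_elt * (?c (Suc (Suc n)) * u1_elt - ?c (Suc n) * dlt)
      - dlt * (?c (Suc n) * u1_elt - ?c n * dlt)"
    unfolding ge2 ..
  also have "\<dots> = (u1_elt * ?c (Suc (Suc n)) - dlt * ?c (Suc n)) * u1_elt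
      - (u1_elt * ?c (Suc n) - dlt * ?c n) * dlt"
    by (simp add: left_diff_distrib right_diff_distrib mult.assoc del: chain.simps)
  finally show ?case by (simp only: chain.simps(3))
qed (use assms in simp_all)

text \<open>\<open>dlt\<close> has degree (2, 0, -2), twice that of \<open>u1_elt\<close>, so both
  terms of the recursion have the same degree.\<close>

lemma y_degree_chain:
  assumes "y_degree x a b c" "y_degree y (a + 1) b (c - 1)"
  shows "y_degree (chain x y n) (a + int n) b (c - int n)"
proof (induction n rule: induct_nat_012)
  case (ge2 n)
  have "y_degree (u1_elt * chain x y (Suc n)) (1 + (a + int (Suc n))) (0 + b) (-1 + (c - int (Suc n)))"
    by (intro y_degree_mult y_degree_u1 ge2)
  moreover have "y_degree (dlt * chain x y n) (2 + (a + int n)) (0 + b) (-2 + (c - int n))"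
    by (intro y_degree_mult y_degree_XX ge2) simp_all
  ultimately show ?case
    using y_degree_diff by (force simp: algebra_simps)
qed (use assms in simp_all)

text \<open>The coordinate sum of the degree does not depend on n, so one power of q serves for the
  whole chain.\<close>

lemma chain_dlt:
  assumes "y_degree x a b c" "y_degree y (a + 1) b (c - 1)"
  shows "chain x y n * dlt = qh (2 * (a + b + c)) * (dlt * chain x y n)"
  using y_degree_chain[OF assms, of n] by (simp add: y_degree_def algebra_simps)

lemma chain_exchange:
  assumes right: "\<And>n. chain x y (Suc (Suc n)) = chain x y (Suc n) * u1_elt - chain x y n * dlt"
    and deg: "y_degree x a b c" "y_degree y (a + 1) b (c - 1)"
    and base: "x * y' = y * x' + qh e * ymon i j k"
    and drift: "a + b + c + i - k = 0"
  shows "chain x y n * chain x' y' (Suc n) =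
      chain x y (Suc n) * chain x' y' n + qh e * ymon (i + int n) (j + int n) (k + int n)"
proof (induction n)
  case (Suc n)
  let ?c = "chain x y" and ?d = "chain x' y'" and ?s = "2 * (a + b + c)"
  have comm: "?c n * dlt = qh ?s * (dlt * ?c n)" for n
    by (rule chain_dlt) (fact deg)+
  have "?c (Suc n) * ?d (Suc (Suc n)) - ?c (Suc (Suc n)) * ?d (Suc n)
      = ?c (Suc n) * (u1_elt * ?d (Suc n) - dlt * ?d n)
        - (?c (Suc n) * u1_elt - ?c n * dlt) * ?d (Suc n)"
    by (simp only: right[of n, symmetric] chain.simps(3)[symmetric])
  also have "\<dots> = ?c n * dlt * ?d (Suc n) - ?c (Suc n) * dlt * ?d n"
    by (simp add: left_diff_distrib right_diff_distrib mult.assoc)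
  also have "\<dots> = qh ?s * (dlt * (?c n * ?d (Suc n) - ?c (Suc n) * ?d n))"
    by (simp add: comm right_diff_distrib mult.assoc)
  also have "?c n * ?d (Suc n) - ?c (Suc n) * ?d n = qh e * ymon (i + int n) (j + int n) (k + int n)"
    using Suc by simp
  also have "qh ?s * (dlt * \<dots>) = qh e * ymon (i + int (Suc n)) (j + int (Suc n)) (k + int (Suc n))"
  proof -
    have "k = a + b + c + i" using drift by simp
    then show ?thesis by (simp add: torus_eval) (simp add: algebra_simps)
  qed
  finally show ?case by (simp add: algebra_simps)
qed (use base in simp)

text \<open>The argument of \<open>chain_exchange\<close> with both chains equal: the commutator is
  multiplied by q^s \<open>dlt\<close> in each step and starts at 0.\<close>

lemma chain_commute:
  assumes right: "\<And>n. chain x y (Suc (Suc n)) = chain x y (Suc n) * u1_elt - chain x y n * dlt"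
    and deg: "y_degree x a b c" "y_degree y (a + 1) b (c - 1)"
    and base: "x * y = y * x"
  shows "chain x y n * chain x y (Suc n) = chain x y (Suc n) * chain x y n"
proof (induction n)
  case (Suc n)
  let ?c = "chain x y" and ?s = "2 * (a + b + c)"
  have comm: "?c n * dlt = qh ?s * (dlt * ?c n)" for n
    by (rule chain_dlt) (fact deg)+
  have "?c (Suc n) * ?c (Suc (Suc n)) - ?c (Suc (Suc n)) * ?c (Suc n)
      = ?c (Suc n) * (u1_elt * ?c (Suc n) - dlt * ?c n)
        - (?c (Suc n) * u1_elt - ?c n * dlt) * ?c (Suc n)"
    by (simp only: right[of n, symmetric] chain.simps(3)[symmetric])
  also have "\<dots> = ?c n * dlt * ?c (Suc n) - ?c (Suc n) * dlt * ?c n"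
    by (simp add: left_diff_distrib right_diff_distrib mult.assoc)
  also have "\<dots> = qh ?s * (dlt * (?c n * ?c (Suc n) - ?c (Suc n) * ?c n))"
    by (simp add: comm right_diff_distrib mult.assoc)
  also have "\<dots> = 0"
    using Suc by simp
  finally show ?case by simp
qed (use base in simp)

section \<open>Closed solution of the recursion\<close>

lemma u_elt_dlt: "u_elt n * dlt = dlt * u_elt n"
proof (induction n rule: u_elt.induct)
  case 3
  have "u1_elt * u1_elt * dlt = dlt * (u1_elt * u1_elt)"
    by (simp only: mult.assoc u1_dlt) (simp only: mult.assoc[symmetric] u1_dlt)
  then show ?case
    by (simp add: left_diff_distrib right_diff_distrib power2_eq_square mult_2 distrib_left distrib_right)
next
  case (4 n)
  have "u1_elt * v * dlt = dlt * (u1_elt * v)" if "v * dlt = dlt * v" for v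
    by (simp only: mult.assoc that) (simp only: mult.assoc[symmetric] u1_dlt)
  with 4 show ?case
    by (simp only: u_elt.simps left_diff_distrib right_diff_distrib mult.assoc)
qed (simp_all add: u1_dlt)

text \<open>As with Chebyshev polynomials: the \<open>u_elt n\<close> with n > 0 are of the first
  kind, the chain is of the second kind, and the latter is a sum of the former in steps of two. The
  convention \<open>u_elt 0 = 1\<close>, in place of 2, gives the last summand its weight for even
  n.\<close>

lemma chain_one: "chain 1 u1_elt n = (\<Sum>l = 0..n div 2. u_elt (n - 2 * l) * dlt ^ l)"
  (is "_ = ?S n")
proof -
  have S: "?S (Suc (Suc n)) = u_elt (Suc (Suc n)) + dlt * ?S n" for n
  proof -
    have "?S (Suc (Suc n)) = u_elt (Suc (Suc n))
        + (\<Sum>l = 0..n div 2. u_elt (n - 2 * l) * dlt ^ Suc l)"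
      by (simp add: sum.atLeast0_atMost_Suc_shift del: power_Suc sum.cl_ivl_Suc)
    also have "(\<Sum>l = 0..n div 2. u_elt (n - 2 * l) * dlt ^ Suc l) = dlt * ?S n"
      unfolding sum_distrib_left
      by (intro sum.cong refl) (simp add: mult.assoc[symmetric] u_elt_dlt)
    finally show ?thesis .
  qed
  have S01: "?S 0 = 1" "?S (Suc 0) = u1_elt"
    by simp_all
  \<comment> \<open>The general step splits off the top term of three sums, which needs indices at
    least 2; hence the values 0 and 1 are separate. At 0 the summand \<open>dlt\<close> of S_2
    reduces the doubled \<open>dlt\<close> in u_2 to the single one of the recursion.\<close>
  have rec: "?S (Suc (Suc n)) = u1_elt * ?S (Suc n) - dlt * ?S n" for n
  proof (induction n rule: induct_nat_012)
    case 0
    show ?case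
      unfolding S S01 by (simp add: power2_eq_square mult_2)
  next
    case 1
    show ?case
      unfolding S[of "Suc 0"] S[of 0] S01 by (simp add: distrib_left u1_dlt)
  next
    case (ge2 n)
    have "?S (Suc (Suc (Suc (Suc n)))) = u_elt (Suc (Suc (Suc (Suc n)))) + dlt * ?S (Suc (Suc n))"
      by (rule S)
    also have "\<dots> = u1_elt * u_elt (Suc (Suc (Suc n))) - dlt * u_elt (Suc (Suc n))
        + dlt * (u1_elt * ?S (Suc n) - dlt * ?S n)"
      by (simp only: ge2 u_elt.simps)
    also have "\<dots> = u1_elt * (u_elt (Suc (Suc (Suc n))) + dlt * ?S (Suc n))
        - dlt * (u_elt (Suc (Suc n)) + dlt * ?S n)"
      by (simp only: distrib_left right_diff_distrib mult.assoc[symmetric] u1_dlt) simp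
    finally show ?case
      unfolding S .
  qed
  show ?thesis
  proof (induction n rule: induct_nat_012)
    case (ge2 n)
    then show ?case
      by (simp only: rec chain.simps)
  qed simp_all
qed

text \<open>The recursion multiplies from the left, so the starting values stay on the right as
  factors; both sides satisfy it with the same first two values.\<close>

lemma chain_formula:
  "chain x y (Suc (Suc n)) = chain 1 u1_elt (Suc n) * y - chain 1 u1_elt n * (dlt * x)"
proof (induction n rule: induct_nat_012)
  case (ge2 n)
  have "chain x y (Suc (Suc (Suc (Suc n)))) = u1_elt * chain x y (Suc (Suc (Suc n))) - dlt * chain x y (Suc (Suc n))"
    by (rule chain.simps)
  also have "\<dots> = (u1_elt * chain 1 u1_elt (Suc (Suc n)) - dlt * chain 1 u1_elt (Suc n)) * y
      - (u1_elt * chain 1 u1_elt (Suc n) - dlt * chain 1 u1_elt n) * (dlt * x)"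
    unfolding ge2 by (simp add: left_diff_distrib right_diff_distrib mult.assoc del: chain.simps)
  finally show ?case
    by (simp only: chain.simps(3))
qed (simp_all add: left_diff_distrib right_diff_distrib mult.assoc)

text \<open>\<open>qh (-3) * dlt\<close> is the product y_1 y_2 y_3. Moving one such factor to the
  left across t gives q^(s - 3/2) with s = a + b + c, and the leading scalar undoes this l times.
  For s = -1 and s = 1 that scalar is q^(5l/2) and q^(l/2), the powers in the theorem.\<close>

lemma y_power_collect:
  assumes "y_degree t a b c"
  shows "qh ((3 - 2 * (a + b + c)) * int l) * U * t * (qh (-3) * dlt) ^ l = U * dlt ^ l * t"
proof (induction l)
  case (Suc l)
  let ?s = "2 * (a + b + c)"
  have t: "t * dlt = qh ?s * (dlt * t)"
    using assms by (simp add: y_degree_def)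
  have "qh ((3 - ?s) * int (Suc l)) = qh (3 - ?s) * qh ((3 - ?s) * int l)"
    by (simp add: qh_add[symmetric] algebra_simps)
  then have "qh ((3 - ?s) * int (Suc l)) * U * t * (qh (-3) * dlt) ^ Suc l
      = qh (3 - ?s) * (qh ((3 - ?s) * int l) * U * t * (qh (-3) * dlt) ^ l) * (qh (-3) * dlt)"
    by (simp only: power_Suc2 mult.assoc)
  also have "\<dots> = qh (3 - ?s) * (U * dlt ^ l * (t * (qh (-3) * dlt)))"
    unfolding Suc by (simp only: mult.assoc)
  also have "t * (qh (-3) * dlt) = qh (-3) * qh ?s * (dlt * t)"
    by (simp only: qh_left_commute[of t] t mult.assoc)
  also have "qh (3 - ?s) * (U * dlt ^ l * (qh (-3) * qh ?s * (dlt * t)))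
      = qh (3 - ?s) * (qh (-3) * qh ?s) * (U * dlt ^ Suc l * t)"
    by (simp only: qh_left_commute[of U] qh_left_commute[of "dlt ^ l"] mult.assoc power_Suc2)
  also have "qh (3 - ?s) * (qh (-3) * qh ?s) = 1"
    by (simp add: qh_add[symmetric] qh_0)
  also have "1 * (U * dlt ^ Suc l * t) = U * dlt ^ Suc l * t"
    by simp
  finally show ?case .
qed (simp add: qh_0)

section \<open>The four sequences of cluster variables\<close>

definition X0_elt :: qtorus where
  "X0_elt = XX (1, 1, -1, 0, 0, 1) + XX (0, 0, -1, 0, 0, 0)"

definition X4_elt :: qtorus where
  "X4_elt = XX (-1, 1, 1, 0, 0, 0) + XX (-1, 0, 0, 1, 0, 0)"

definition Xm1_elt :: qtorus where
  "Xm1_elt = XX (2, 0, -1, 0, 1, 1) + XX (1, -1, -1, 0, 1, 0) + XX (0, -1, 0, 0, 0, 0)"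

lemmas elt_defs = X0_elt_def X4_elt_def Xm1_elt_def

definition odd_pos :: "nat \<Rightarrow> qtorus" where
  "odd_pos = chain (XX (1, 0, 0, 0, 0, 0)) (XX (0, 0, 1, 0, 0, 0))"

definition even_pos :: "nat \<Rightarrow> qtorus" where
  "even_pos = chain (XX (0, 1, 0, 0, 0, 0)) X4_elt"

text \<open>
  The entries at 0 of the next two sequences are not cluster variables: they are what the recursion
  produces one step before $X_0$ and $X_{-1}$.
\<close>

definition even_neg :: "nat \<Rightarrow> qtorus" where
  "even_neg = chain (monom 0 (0, 1, 0, -1, -1, 0)) X0_elt"

definition odd_neg :: "nat \<Rightarrow> qtorus" where
  "odd_neg = chain (monom 0 (1, 0, 0, -1, 0, 0)) Xm1_elt"

section \<open>Right recursion, degrees and commutation within each sequence\<close>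

lemma odd_pos_right:
  "odd_pos (Suc (Suc n)) = odd_pos (Suc n) * u1_elt - odd_pos n * dlt"
  unfolding odd_pos_def by (rule chain_right) (simp_all add: u1_elt_eval torus_eval)

lemma even_pos_right:
  "even_pos (Suc (Suc n)) = even_pos (Suc n) * u1_elt - even_pos n * dlt"
  unfolding even_pos_def by (rule chain_right) (simp_all add: elt_defs u1_elt_eval torus_eval)

lemma even_neg_right:
  "even_neg (Suc (Suc n)) = even_neg (Suc n) * u1_elt - even_neg n * dlt"
  unfolding even_neg_def by (rule chain_right) (simp_all add: elt_defs u1_elt_eval torus_eval)

lemma odd_neg_right:
  "odd_neg (Suc (Suc n)) = odd_neg (Suc n) * u1_elt - odd_neg n * dlt"
  unfolding odd_neg_def by (rule chain_right) (simp_all add: elt_defs u1_elt_eval torus_eval)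

lemma odd_pos_degree: "y_degree (odd_pos n) (int n - 1) 0 (- int n)"
proof -
  have "y_degree (odd_pos n) (-1 + int n) 0 (0 - int n)"
    unfolding odd_pos_def by (intro y_degree_chain y_degree_XX) simp_all
  then show ?thesis by simp
qed

lemma even_pos_degree: "y_degree (even_pos n) (int n) (-1) (- int n)"
proof -
  have "y_degree (even_pos n) (0 + int n) (-1) (0 - int n)"
    unfolding even_pos_def elt_defs by (intro y_degree_chain y_degree_add y_degree_XX) simp_all
  then show ?thesis by simp
qed

lemma even_neg_degree: "y_degree (even_neg n) (int n - 1) 0 (2 - int n)"
proof -
  have "y_degree (even_neg n) (-1 + int n) 0 (2 - int n)"
    unfolding even_neg_def elt_defs
    by (intro y_degree_chain y_degree_add y_degree_XX y_degree_monom) simp_all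
  then show ?thesis by simp
qed

lemma odd_neg_degree: "y_degree (odd_neg n) (int n - 1) 1 (1 - int n)"
proof -
  have "y_degree (odd_neg n) (-1 + int n) 1 (1 - int n)"
    unfolding odd_neg_def elt_defs
    by (intro y_degree_chain y_degree_add y_degree_XX y_degree_monom) simp_all
  then show ?thesis by simp
qed

lemma odd_pos_commute: "odd_pos n * odd_pos (Suc n) = odd_pos (Suc n) * odd_pos n"
  unfolding odd_pos_def
  by (rule chain_commute[OF odd_pos_right[unfolded odd_pos_def], where a = "-1" and b = 0 and c = 0])
     (auto intro!: y_degree_monom simp: torus_eval)

lemma even_pos_commute: "even_pos n * even_pos (Suc n) = even_pos (Suc n) * even_pos n"
  unfolding even_pos_def
  by (rule chain_commute[OF even_pos_right[unfolded even_pos_def], where a = 0 and b = "-1" and c = 0])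
     (auto intro!: y_degree_add y_degree_monom simp: elt_defs torus_eval)

lemma even_neg_commute: "even_neg n * even_neg (Suc n) = even_neg (Suc n) * even_neg n"
  unfolding even_neg_def
  by (rule chain_commute[OF even_neg_right[unfolded even_neg_def], where a = "-1" and b = 0 and c = 2])
     (auto intro!: y_degree_add y_degree_monom simp: elt_defs torus_eval)

lemma odd_neg_commute: "odd_neg n * odd_neg (Suc n) = odd_neg (Suc n) * odd_neg n"
  unfolding odd_neg_def
  by (rule chain_commute[OF odd_neg_right[unfolded odd_neg_def], where a = "-1" and b = 1 and c = 1])
     (auto intro!: y_degree_add y_degree_monom simp: elt_defs torus_eval)

section \<open>Exchange relations between the sequences\<close>

lemma exchange_odd_pos:
  "odd_pos n * even_pos (Suc n) =
     odd_pos (Suc n) * even_pos n + qh (-1) * ymon (int n + 1) (int n) (int n)"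
proof -
  have "odd_pos n * even_pos (Suc n) =
     odd_pos (Suc n) * even_pos n + qh (-1) * ymon (1 + int n) (0 + int n) (0 + int n)"
    unfolding odd_pos_def even_pos_def
    by (rule chain_exchange[OF odd_pos_right[unfolded odd_pos_def], where a = "-1" and b = 0 and c = 0])
       (auto intro!: y_degree_monom simp: elt_defs torus_eval)
  then show ?thesis by (simp add: add.commute)
qed

lemma exchange_even_pos:
  "even_pos n * odd_pos (Suc (Suc n)) =
     even_pos (Suc n) * odd_pos (Suc n) + qh (-1) * ymon (int n + 1) (int n + 1) (int n)"
proof -
  have "even_pos n * odd_pos (Suc (Suc n)) =
     even_pos (Suc n) * odd_pos (Suc n) + qh (-1) * ymon (1 + int n) (1 + int n) (0 + int n)"
    \<comment> \<open>\<open>chain_shift\<close> starts the odd sequence at its entry 1, so that the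
      indices have the form required by \<open>chain_exchange\<close>.\<close>
    unfolding odd_pos_def even_pos_def chain_shift[symmetric, of _ _ "Suc _"]
      chain_shift[symmetric, of "XX (1, 0, 0, 0, 0, 0)"]
    by (rule chain_exchange[OF even_pos_right[unfolded even_pos_def], where a = 0 and b = "-1" and c = 0])
       (auto intro!: y_degree_add y_degree_monom simp: u1_elt_eval elt_defs torus_eval)
  then show ?thesis by (simp add: add.commute)
qed

lemma exchange_even_neg:
  "even_neg n * odd_neg (Suc n) =
     even_neg (Suc n) * odd_neg n + qh 1 * ymon (int n - 1) (int n - 1) (int n)"
proof -
  have "even_neg n * odd_neg (Suc n) =
     even_neg (Suc n) * odd_neg n + qh 1 * ymon (-1 + int n) (-1 + int n) (0 + int n)"
    unfolding odd_neg_def even_neg_def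
    by (rule chain_exchange[OF even_neg_right[unfolded even_neg_def], where a = "-1" and b = 0 and c = 2])
       (auto intro!: y_degree_add y_degree_monom simp: elt_defs torus_eval)
  then show ?thesis by simp
qed

lemma exchange_odd_neg:
  "odd_neg n * even_neg (Suc (Suc n)) =
     odd_neg (Suc n) * even_neg (Suc n) + qh 1 * ymon (int n - 1) (int n) (int n)"
proof -
  have "odd_neg n * even_neg (Suc (Suc n)) =
     odd_neg (Suc n) * even_neg (Suc n) + qh 1 * ymon (-1 + int n) (0 + int n) (0 + int n)"
    unfolding odd_neg_def even_neg_def chain_shift[symmetric, of _ _ "Suc _"]
      chain_shift[symmetric, of "monom 0 (0, 1, 0, -1, -1, 0)"]
    by (rule chain_exchange[OF odd_neg_right[unfolded odd_neg_def], where a = "-1" and b = 1 and c = 1])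
       (auto intro!: y_degree_add y_degree_monom simp: u1_elt_eval elt_defs torus_eval)
  then show ?thesis by simp
qed

section \<open>Augmentation\<close>

text \<open>
  Setting $q$ and all generators to 1 turns the recursion into $a_{n+2} = 4 a_{n+1} - a_n$, which
  preserves $0 < a_n \<le> a_{n+1}$. This is why no cluster variable vanishes.
\<close>

definition coeff_sum :: "('a \<Rightarrow>\<^sub>0 'b::comm_monoid_add) \<Rightarrow> 'b" where
  "coeff_sum f = (\<Sum>a\<in>Poly_Mapping.keys f. Poly_Mapping.lookup f a)"

lemma coeff_sum_superset:
  "finite A \<Longrightarrow> Poly_Mapping.keys f \<subseteq> A \<Longrightarrow> coeff_sum f = (\<Sum>a\<in>A. Poly_Mapping.lookup f a)"
  unfolding coeff_sum_def by (intro sum.mono_neutral_left) (auto simp: in_keys_iff)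

lemma coeff_sum_add: "coeff_sum (f + g) = coeff_sum f + coeff_sum g"
proof -
  let ?A = "Poly_Mapping.keys f \<union> Poly_Mapping.keys g"
  have "Poly_Mapping.keys (f + g) \<subseteq> ?A"
    by (rule Poly_Mapping.keys_add)
  then show ?thesis
    by (simp add: coeff_sum_superset[of ?A] lookup_add sum.distrib)
qed

lemma coeff_sum_zero [simp]: "coeff_sum 0 = 0"
  by (simp add: coeff_sum_def)

lemma coeff_sum_single [simp]: "coeff_sum (Poly_Mapping.single a b) = b"
  by (subst coeff_sum_superset[of "{a}"]) auto

lemma coeff_sum_qlaurent_mult:
  fixes f g :: qlaurent
  shows "coeff_sum (f * g) = coeff_sum f * coeff_sum g"
proof -
  have single: "coeff_sum (Poly_Mapping.single a b * g) = b * coeff_sum g" for a b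
  proof (induction g rule: update_induct)
    case (update g c d)
    have *: "Poly_Mapping.update c d g = g + Poly_Mapping.single c d"
      using update.hyps
      by (intro poly_mapping_eqI) (auto simp: lookup_update lookup_add lookup_single when_def in_keys_iff)
    show ?case
      unfolding * using update.IH by (simp add: distrib_left coeff_sum_add mult_single)
  qed simp
  show ?thesis
  proof (induction f rule: update_induct)
    case (update f c d)
    have *: "Poly_Mapping.update c d f = f + Poly_Mapping.single c d"
      using update.hyps
      by (intro poly_mapping_eqI) (auto simp: lookup_update lookup_add lookup_single when_def in_keys_iff)
    show ?case
      unfolding * using update.IH by (simp add: distrib_right coeff_sum_add single)
  qed simp
qed

text \<open>The inner sum sends every \<open>XX c\<close> to 1, the outer one sends q^(1/2) to
  1.\<close>

lift_definition augmentation :: "qtorus \<Rightarrow> int" is "\<lambda>f. coeff_sum (coeff_sum f)" .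

lemma augmentation_add: "augmentation (s + t) = augmentation s + augmentation t"
  by transfer (simp add: coeff_sum_add)

lemma augmentation_diff: "augmentation (s - t) = augmentation s - augmentation t"
  using augmentation_add[of "s - t" t] by simp

text \<open>At q = 1 the factor \<open>qp\<close> in the twisted product becomes 1, so the product
  is that of a commutative group ring.\<close>

lemma augmentation_mult: "augmentation (s * t) = augmentation s * augmentation t"
proof transfer
  fix s t
  show "coeff_sum (coeff_sum (twist s t)) = coeff_sum (coeff_sum s) * coeff_sum (coeff_sum t)"
  proof (induction s rule: poly_mapping_additive_induct)
    case (2 c a)
    show ?case
      by (induction t rule: poly_mapping_additive_induct)
         (simp_all add: twist_single twist_add_right coeff_sum_add coeff_sum_qlaurent_mult qp_def algebra_simps)
  qed (simp_all add: twist_add_left coeff_sum_add algebra_simps)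
qed

lemma augmentation_XX: "augmentation (XX c) = 1"
  by transfer (simp add: coeff_sum_def)

lemma augmentation_monom: "augmentation (monom a c) = 1"
proof -
  have "augmentation (qh a) = 1"
    by transfer (simp add: qp_def)
  then show ?thesis
    by (simp add: monom_def augmentation_mult augmentation_XX)
qed

lemma augmentation_zero: "augmentation 0 = 0"
  by transfer simp

lemma chain_nonzero:
  assumes "augmentation x > 0" "augmentation y \<ge> augmentation x"
  shows "chain x y n \<noteq> 0"
proof -
  have "augmentation (chain x y n) > 0 \<and> augmentation (chain x y (Suc n)) \<ge> augmentation (chain x y n)"
  proof (induction n)
    case (Suc n)
    then show ?case
      by (simp add: augmentation_diff augmentation_mult augmentation_XX u1_elt_eval
          augmentation_add augmentation_monom)
  qed (use assms in simp)
  then show ?thesis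
    using augmentation_zero by (metis less_irrefl)
qed

lemma odd_pos_nonzero: "odd_pos n \<noteq> 0"
  and even_pos_nonzero: "even_pos n \<noteq> 0"
  and even_neg_nonzero: "even_neg n \<noteq> 0"
  and odd_neg_nonzero: "odd_neg n \<noteq> 0"
  unfolding odd_pos_def even_pos_def even_neg_def odd_neg_def
  by (rule chain_nonzero; simp add: elt_defs augmentation_XX augmentation_monom augmentation_add)+

section \<open>Mutation of seeds\<close>

lemma ball_1_6: "(\<forall>i\<in>{1..6::nat}. P i) \<longleftrightarrow> P 1 \<and> P 2 \<and> P 3 \<and> P 4 \<and> P 5 \<and> P 6"
proof -
  have "{1..6} = {1, 2, 3, 4, 5, 6::nat}" by auto
  then show ?thesis by (simp only: ball_simps simp_thms)
qed

lemma mutation_matrix_sum: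
  assumes "j \<in> {1..6}" "j \<noteq> k"
  shows "(\<Sum>s\<in>{1..6}. f s * mutation_matrix b k s j) = f j"
    and "(\<Sum>s\<in>{1..6}. mutation_matrix b k s j * f s) = f j"
  using assms by (simp_all add: mutation_matrix_def of_bool_def if_distrib[of "\<lambda>x. _ * x"] if_distrib[of "\<lambda>x. x * _"] cong: if_cong)

text \<open>E differs from the identity only in column k, so only row and column k of the form
  change; the diagonal entry vanishes by skew-symmetry.\<close>

lemma mutate_form_eval:
  assumes skew: "\<And>i j. i \<in> {1..6} \<Longrightarrow> j \<in> {1..6} \<Longrightarrow> L j i = - L i j"
    and ij: "i \<in> {1..6}" "j \<in> {1..6}"
  shows "mutate_form L b k i j =
    (if i = k then if j = k then 0 else (\<Sum>r\<in>{1..6}. mutation_matrix b k r k * L r j)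
     else if j = k then (\<Sum>s\<in>{1..6}. L i s * mutation_matrix b k s k) else L i j)"
proof -
  have outer: "mutate_form L b k i j
      = (\<Sum>r\<in>{1..6}. mutation_matrix b k r i * (\<Sum>s\<in>{1..6}. L r s * mutation_matrix b k s j))"
    by (simp add: mutate_form_def sum_distrib_left mult.assoc)
  show ?thesis
  proof (cases "i = k \<and> j = k")
    case True
    let ?X = "mutate_form L b k k k"
    \<comment> \<open>Interchanging the summation indices and using skew-symmetry shows that
      \<open>?X\<close> is its own negative.\<close>
    have "?X = (\<Sum>s\<in>{1..6}. \<Sum>r\<in>{1..6}. mutation_matrix b k r k * L r s * mutation_matrix b k s k)"
      unfolding mutate_form_def by (rule sum.swap)
    also have "\<dots> = (\<Sum>s\<in>{1..6}. \<Sum>r\<in>{1..6}. - (mutation_matrix b k s k * L s r * mutation_matrix b k r k))"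
    proof (intro sum.cong refl)
      fix r s :: nat
      assume "s \<in> {1..6}" "r \<in> {1..6}"
      then have "L r s = - L s r" by (rule skew)
      then show "mutation_matrix b k r k * L r s * mutation_matrix b k s k
          = - (mutation_matrix b k s k * L s r * mutation_matrix b k r k)"
        by (simp only: mult_minus_left mult_minus_right mult_ac)
    qed
    also have "\<dots> = - ?X"
      by (simp add: mutate_form_def sum_negf)
    finally show ?thesis using True by simp
  next
    case False
    then show ?thesis
      unfolding outer using ij by (auto simp: mutation_matrix_sum[unfolded One_nat_def])
  qed
qed

text \<open>
  In all seeds $\Sigma_m$ the cluster variables commute, the frozen block of the form is that of
  the initial seed, and the top block of the exchange matrix is constant. What varies are the
  frozen parts: the three rows of the form (degrees) and the three columns of the exchange matrix
  (c-vectors).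
\<close>

type_synonym triple = "int \<times> int \<times> int"

fun seed_form :: "triple \<Rightarrow> triple \<Rightarrow> triple \<Rightarrow> nat \<Rightarrow> nat \<Rightarrow> int" where
  "seed_form (a1, a2, a3) (b1, b2, b3) (c1, c2, c3) i j =
    [[0, 0, 0, a1, a2, a3],
     [0, 0, 0, b1, b2, b3],
     [0, 0, 0, c1, c2, c3],
     [-a1, -b1, -c1, 0, -1, -1],
     [-a2, -b2, -c2, 1, 0, -1],
     [-a3, -b3, -c3, 1, 1, 0]] ! (i - 1) ! (j - 1)"

fun seed_bmat :: "triple \<Rightarrow> triple \<Rightarrow> triple \<Rightarrow> nat \<Rightarrow> nat \<Rightarrow> int" where
  "seed_bmat (a1, a2, a3) (b1, b2, b3) (c1, c2, c3) i j =
    [[0, 1, 1],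
     [-1, 0, 1],
     [-1, -1, 0],
     [a1, b1, c1],
     [a2, b2, c2],
     [a3, b3, c3]] ! (i - 1) ! (j - 1)"

text \<open>Entries outside the index range carry no meaning, so only the range is
  constrained.\<close>

definition has_form where
  "has_form S d1 d2 d3 \<longleftrightarrow> (\<forall>i\<in>{1..6}. \<forall>j\<in>{1..6}. form S i j = seed_form d1 d2 d3 i j)"

definition has_bmat where
  "has_bmat S g1 g2 g3 \<longleftrightarrow> (\<forall>i\<in>{1..6}. bmat S i 1 = seed_bmat g1 g2 g3 i 1
     \<and> bmat S i 2 = seed_bmat g1 g2 g3 i 2 \<and> bmat S i 3 = seed_bmat g1 g2 g3 i 3)"

lemma has_form_skew:
  assumes "has_form S d1 d2 d3" "i \<in> {1..6}" "j \<in> {1..6}"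
  shows "form S j i = - form S i j"
proof -
  obtain a1 a2 a3 b1 b2 b3 c1 c2 c3 where
    [simp]: "d1 = (a1, a2, a3)" "d2 = (b1, b2, b3)" "d3 = (c1, c2, c3)"
    by (cases d1, cases d2, cases d3)
  have "\<forall>i\<in>{1..6}. \<forall>j\<in>{1..6}. seed_form d1 d2 d3 j i = - seed_form d1 d2 d3 i j"
    unfolding ball_1_6 by simp
  then have "seed_form d1 d2 d3 j i = - seed_form d1 d2 d3 i j"
    using assms(2,3) by blast
  moreover have "form S i j = seed_form d1 d2 d3 i j" "form S j i = seed_form d1 d2 d3 j i"
    using assms unfolding has_form_def by blast+
  ultimately show ?thesis by (simp only:)
qed

lemma mutate_has_form:
  assumes S: "has_form S d1 d2 d3" and ij: "i \<in> {1..6}" "j \<in> {1..6}"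
  shows "mutate_form (form S) b k i j =
    (if i = k then if j = k then 0 else (\<Sum>r\<in>{1..6}. mutation_matrix b k r k * seed_form d1 d2 d3 r j)
     else if j = k then (\<Sum>s\<in>{1..6}. seed_form d1 d2 d3 i s * mutation_matrix b k s k)
     else seed_form d1 d2 d3 i j)"
proof -
  have f: "form S i j = seed_form d1 d2 d3 i j" if "i \<in> {1..6}" "j \<in> {1..6}" for i j
    using S that by (simp add: has_form_def)
  have "mutate_form (form S) b k i j =
    (if i = k then if j = k then 0 else (\<Sum>r\<in>{1..6}. mutation_matrix b k r k * form S r j)
     else if j = k then (\<Sum>s\<in>{1..6}. form S i s * mutation_matrix b k s k) else form S i j)"
    by (rule mutate_form_eval[OF has_form_skew[OF S] ij])
  then show ?thesis
    using ij by (simp add: f cong: if_cong)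
qed

text \<open>Row 1 of the top block is (0, 1, 1), so for a nonnegative c-vector the correction in
  \<open>mutate_bmat\<close> is that vector itself.\<close>

lemma next_bmat:
  assumes "has_bmat S (a1, a2, a3) (b1, b2, b3) (c1, c2, c3)" "a1 \<ge> 0" "a2 \<ge> 0" "a3 \<ge> 0"
  shows "has_bmat (next_seed \<iota> S) (a1 + b1, a2 + b2, a3 + b3) (a1 + c1, a2 + c2, a3 + c3) (-a1, -a2, -a3)"
  using assms unfolding has_bmat_def ball_1_6
  by (simp add: next_seed_def reorder_def mutate_def mutate_bmat_def)

lemma uminus_double_div_2: "- (2 * x) div 2 = - (x :: int)"
  by presburger

text \<open>Row 3 of the top block is (-1, -1, 0). For a nonpositive c-vector the two products in
  the correction agree, and the correction is the c-vector itself.\<close>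

lemma prev_bmat_neg:
  assumes "has_bmat S (a1, a2, a3) (b1, b2, b3) (-c1, -c2, -c3)" "c1 \<ge> 0" "c2 \<ge> 0" "c3 \<ge> 0"
  shows "has_bmat (prev_seed \<iota> S) (c1, c2, c3) (a1 - c1, a2 - c2, a3 - c3) (b1 - c1, b2 - c2, b3 - c3)"
  using assms unfolding has_bmat_def ball_1_6
  by (simp add: prev_seed_def reorder_def mutate_def mutate_bmat_def uminus_double_div_2)

text \<open>For a nonnegative c-vector the two products in the correction cancel.\<close>

lemma prev_bmat_pos:
  assumes "has_bmat S (a1, a2, a3) (b1, b2, b3) (c1, c2, c3)" "c1 \<ge> 0" "c2 \<ge> 0" "c3 \<ge> 0"
  shows "has_bmat (prev_seed \<iota> S) (-c1, -c2, -c3) (a1, a2, a3) (b1, b2, b3)"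
  using assms unfolding has_bmat_def ball_1_6
  by (simp add: prev_seed_def reorder_def mutate_def mutate_bmat_def)

text \<open>Column 1 has top entries 0, -1, -1 and nonnegative frozen entries, so E replaces e_1 by
  -e_1 + e_2 + e_3.\<close>

lemma next_form:
  assumes f: "has_form S (a1, a2, a3) (b1, b2, b3) (c1, c2, c3)"
    and b: "has_bmat S (g1, g2, g3) e2 e3" "g1 \<ge> 0" "g2 \<ge> 0" "g3 \<ge> 0"
  shows "has_form (next_seed \<iota> S) (b1, b2, b3) (c1, c2, c3) (b1 + c1 - a1, b2 + c2 - a2, b3 + c3 - a3)"
proof -
  let ?L = "seed_form (a1, a2, a3) (b1, b2, b3) (c1, c2, c3)"
  have M: "mutation_matrix (bmat S) 1 1 1 = -1" "mutation_matrix (bmat S) 1 2 1 = 1"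
      "mutation_matrix (bmat S) 1 3 1 = 1" "mutation_matrix (bmat S) 1 4 1 = 0"
      "mutation_matrix (bmat S) 1 5 1 = 0" "mutation_matrix (bmat S) 1 6 1 = 0"
    using b unfolding has_bmat_def ball_1_6 by (cases e2; cases e3; simp add: mutation_matrix_def)+
  have m: "mutate_form (form S) (bmat S) 1 i j =
     (if i = 1 then if j = 1 then 0 else ?L 2 j + ?L 3 j - ?L 1 j
      else if j = 1 then ?L i 2 + ?L i 3 - ?L i 1 else ?L i j)"
    if "i \<in> {1..6}" "j \<in> {1..6}" for i j
    unfolding mutate_has_form[OF f that] sum_1_6 M
    by (simp del: seed_form.simps One_nat_def)
  show ?thesis
    unfolding has_form_def ball_1_6
    by (simp add: next_seed_def reorder_def mutate_def m[unfolded One_nat_def])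
qed

lemma prev_form_neg:
  assumes f: "has_form S (a1, a2, a3) (b1, b2, b3) (c1, c2, c3)"
    and b: "has_bmat S e1 e2 (-h1, -h2, -h3)" "h1 \<ge> 0" "h2 \<ge> 0" "h3 \<ge> 0"
    and compat: "a1 * h1 + a2 * h2 + a3 * h3 = 0" "b1 * h1 + b2 * h2 + b3 * h3 = 0"
  shows "has_form (prev_seed \<iota> S) (h2 + h3 - c1, h3 - h1 - c2, - h1 - h2 - c3) (a1, a2, a3) (b1, b2, b3)"
proof -
  let ?L = "seed_form (a1, a2, a3) (b1, b2, b3) (c1, c2, c3)"
  have M: "mutation_matrix (bmat S) 3 1 3 = 0" "mutation_matrix (bmat S) 3 2 3 = 0"
      "mutation_matrix (bmat S) 3 3 3 = -1" "mutation_matrix (bmat S) 3 4 3 = h1"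
      "mutation_matrix (bmat S) 3 5 3 = h2" "mutation_matrix (bmat S) 3 6 3 = h3"
    using b unfolding has_bmat_def ball_1_6 by (cases e1; cases e2; simp add: mutation_matrix_def)+
  have m: "mutate_form (form S) (bmat S) 3 i j =
     (if i = 3 then if j = 3 then 0 else h1 * ?L 4 j + h2 * ?L 5 j + h3 * ?L 6 j - ?L 3 j
      else if j = 3 then h1 * ?L i 4 + h2 * ?L i 5 + h3 * ?L i 6 - ?L i 3 else ?L i j)"
    if "i \<in> {1..6}" "j \<in> {1..6}" for i j
    unfolding mutate_has_form[OF f that] sum_1_6 M
    by (simp del: seed_form.simps One_nat_def)
  show ?thesis
    unfolding has_form_def ball_1_6 using compat
    by (simp add: next_seed_def reorder_def mutate_def prev_seed_def m[unfolded One_nat_def] mult.commute)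
qed

text \<open>Column 3 has no negative entry, so E only negates e_3.\<close>

lemma prev_form_pos:
  assumes f: "has_form S (a1, a2, a3) (b1, b2, b3) (c1, c2, c3)"
    and b: "has_bmat S e1 e2 (h1, h2, h3)" "h1 \<ge> 0" "h2 \<ge> 0" "h3 \<ge> 0"
  shows "has_form (prev_seed \<iota> S) (- c1, - c2, - c3) (a1, a2, a3) (b1, b2, b3)"
proof -
  let ?L = "seed_form (a1, a2, a3) (b1, b2, b3) (c1, c2, c3)"
  have M: "mutation_matrix (bmat S) 3 1 3 = 0" "mutation_matrix (bmat S) 3 2 3 = 0"
      "mutation_matrix (bmat S) 3 3 3 = -1" "mutation_matrix (bmat S) 3 4 3 = 0"
      "mutation_matrix (bmat S) 3 5 3 = 0" "mutation_matrix (bmat S) 3 6 3 = 0"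
    using b unfolding has_bmat_def ball_1_6 by (cases e1; cases e2; simp add: mutation_matrix_def)+
  have m: "mutate_form (form S) (bmat S) 3 i j =
     (if i = 3 then if j = 3 then 0 else - ?L 3 j else if j = 3 then - ?L i 3 else ?L i j)"
    if "i \<in> {1..6}" "j \<in> {1..6}" for i j
    unfolding mutate_has_form[OF f that] sum_1_6 M
    by (simp del: seed_form.simps One_nat_def)
  show ?thesis
    unfolding has_form_def ball_1_6
    by (simp add: prev_seed_def reorder_def mutate_def m[unfolded One_nat_def])
qed

section \<open>Cancellation and commutation by way of the skew-field\<close>

locale torus_fractions =
  fixes \<iota> :: "qtorus \<Rightarrow> 'f::division_ring"
  assumes fractions: "skew_field_of_fractions \<iota>"
begin

lemma iota_one: "\<iota> 1 = 1"
  and iota_add: "\<iota> (s + t) = \<iota> s + \<iota> t"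
  and iota_mult: "\<iota> (s * t) = \<iota> s * \<iota> t"
  and iota_inj: "inj \<iota>"
  using fractions by (auto simp: skew_field_of_fractions_def)

lemma iota_eq_iff: "\<iota> s = \<iota> t \<longleftrightarrow> s = t"
  using iota_inj by (rule inj_eq)

lemma iota_zero: "\<iota> 0 = 0"
  using iota_add[of 0 0] by simp

lemma iota_diff: "\<iota> (s - t) = \<iota> s - \<iota> t"
  using iota_add[of "s - t" t] by simp

lemma iota_power: "\<iota> (s ^ n) = \<iota> s ^ n"
  by (induction n) (simp_all add: iota_one iota_mult)

lemma iota_sum: "\<iota> (sum f A) = (\<Sum>a\<in>A. \<iota> (f a))"
  by (induction A rule: infinite_finite_induct) (simp_all add: iota_zero iota_add)

text \<open>The torus has no zero divisors, because it embeds in a division ring.\<close>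

lemma mult_left_cancel_torus:
  assumes "s \<noteq> 0" "s * t = s * t'"
  shows "t = (t' :: qtorus)"
  using assms by (metis iota_eq_iff iota_mult iota_zero mult_left_cancel)

lemma iota_inverse:
  assumes "v * w = 1"
  shows "inverse (\<iota> v) = \<iota> w"
  using assms by (metis inverse_unique iota_mult iota_one)

lemma qh_central_fractions: "x * \<iota> (qh m) = \<iota> (qh m) * x"
proof -
  obtain s t where t: "t \<noteq> 0" and x: "x = \<iota> s * inverse (\<iota> t)"
    using fractions unfolding skew_field_of_fractions_def by blast
  have comm: "\<iota> r * \<iota> (qh m) = \<iota> (qh m) * \<iota> r" for r
    by (simp add: iota_mult[symmetric] qh_central[of m r])
  have "inverse (\<iota> t) * \<iota> (qh m) = \<iota> (qh m) * inverse (\<iota> t)"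
    by (rule mult_commute_imp_mult_inverse_commute[OF comm])
  then show ?thesis
    by (metis comm mult.assoc x)
qed

lemma qh_left_commute_fractions: "x * (\<iota> (qh m) * y) = \<iota> (qh m) * (x * y)"
  by (metis mult.assoc qh_central_fractions)

text \<open>s commutes with v and with the product v v', so v can be cancelled.\<close>

lemma commute_exchange:
  assumes "v \<noteq> 0" "v * v' = m + n" "s * v = v * s" "s * m = m * s" "s * n = n * s"
  shows "s * v' = v' * (s :: qtorus)"
proof (rule mult_left_cancel_torus)
  have "v * (s * v') = s * (v * v')"
    by (simp add: mult.assoc[symmetric] assms(3))
  also have "\<dots> = (v * v') * s"
    by (simp add: assms distrib_left distrib_right)
  finally show "v * (s * v') = v * (v' * s)"
    by (simp add: mult.assoc)
qed fact

text \<open>In the order a_0, b_0, a_1, b_1, ... entries at distance two commute by assumption.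
  Commutation of neighbours moves forward one place at a time: the next entry arises by exchange
  with the entry three places back, and \<open>commute_exchange\<close> applies.\<close>

lemma interlaced_commute:
  fixes a b M N :: "nat \<Rightarrow> qtorus"
  assumes a: "\<And>n. a n \<noteq> 0" "\<And>n. a n * a (Suc n) = a (Suc n) * a n"
    and b: "\<And>n. b n \<noteq> 0" "\<And>n. b n * b (Suc n) = b (Suc n) * b n"
    and M: "\<And>n. a n * b (Suc n) = a (Suc n) * b n + M n" "\<And>n. a (Suc n) * M n = M n * a (Suc n)"
    and N: "\<And>n. b n * a (Suc (Suc n)) = b (Suc n) * a (Suc n) + N n" "\<And>n. b (Suc n) * N n = N n * b (Suc n)"
    and base: "a (Suc 0) * b 0 = b 0 * a (Suc 0)"
  shows "a (Suc n) * b n = b n * a (Suc n)" "a (Suc n) * b (Suc n) = b (Suc n) * a (Suc n)"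
proof -
  have step1: "a (Suc n) * b (Suc n) = b (Suc n) * a (Suc n)" if "a (Suc n) * b n = b n * a (Suc n)" for n
    using mult.assoc[of "a (Suc n)" "b n" "a (Suc n)"] that
    by (intro commute_exchange[OF a(1) M(1)]) (simp_all add: a(2) M(2))
  have step2: "b (Suc n) * a (Suc (Suc n)) = a (Suc (Suc n)) * b (Suc n)"
    if "a (Suc n) * b n = b n * a (Suc n)" for n
    using mult.assoc[of "b (Suc n)" "a (Suc n)" "b (Suc n)"] step1[OF that]
    by (intro commute_exchange[OF b(1) N(1)]) (simp_all add: b(2) N(2))
  show *: "a (Suc n) * b n = b n * a (Suc n)"
    by (induction n) (simp_all add: base step2)
  show "a (Suc n) * b (Suc n) = b (Suc n) * a (Suc n)"
    by (rule step1[OF *])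
qed

lemma pos_commute:
  "odd_pos (Suc n) * even_pos n = even_pos n * odd_pos (Suc n)"
  "odd_pos (Suc n) * even_pos (Suc n) = even_pos (Suc n) * odd_pos (Suc n)"
proof -
  have M: "odd_pos (Suc n) * (qh (-1) * ymon (int n + 1) (int n) (int n))
      = qh (-1) * ymon (int n + 1) (int n) (int n) * odd_pos (Suc n)" for n
    by (rule y_degree_commute[OF odd_pos_degree]) (simp add: algebra_simps)
  have N: "even_pos (Suc n) * (qh (-1) * ymon (int n + 1) (int n + 1) (int n))
      = qh (-1) * ymon (int n + 1) (int n + 1) (int n) * even_pos (Suc n)" for n
    by (rule y_degree_commute[OF even_pos_degree]) (simp add: algebra_simps)
  have "odd_pos (Suc 0) * even_pos 0 = even_pos 0 * odd_pos (Suc 0)"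
    by (simp add: odd_pos_def even_pos_def torus_eval)
  note * = interlaced_commute[of odd_pos even_pos, OF odd_pos_nonzero odd_pos_commute
      even_pos_nonzero even_pos_commute exchange_odd_pos M exchange_even_pos N this]
  show "odd_pos (Suc n) * even_pos n = even_pos n * odd_pos (Suc n)"
    "odd_pos (Suc n) * even_pos (Suc n) = even_pos (Suc n) * odd_pos (Suc n)"
    by (fact *)+
qed

lemma neg_commute:
  "even_neg (Suc n) * odd_neg n = odd_neg n * even_neg (Suc n)"
  "even_neg (Suc n) * odd_neg (Suc n) = odd_neg (Suc n) * even_neg (Suc n)"
proof -
  have M: "even_neg (Suc n) * (qh 1 * ymon (int n - 1) (int n - 1) (int n))
      = qh 1 * ymon (int n - 1) (int n - 1) (int n) * even_neg (Suc n)" for n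
    by (rule y_degree_commute[OF even_neg_degree]) (simp add: algebra_simps)
  have N: "odd_neg (Suc n) * (qh 1 * ymon (int n - 1) (int n) (int n))
      = qh 1 * ymon (int n - 1) (int n) (int n) * odd_neg (Suc n)" for n
    by (rule y_degree_commute[OF odd_neg_degree]) (simp add: algebra_simps)
  have "even_neg (Suc 0) * odd_neg 0 = odd_neg 0 * even_neg (Suc 0)"
    by (simp add: odd_neg_def even_neg_def elt_defs torus_eval)
  note * = interlaced_commute[of even_neg odd_neg, OF even_neg_nonzero even_neg_commute
      odd_neg_nonzero odd_neg_commute exchange_even_neg M exchange_odd_neg N this]
  show "even_neg (Suc n) * odd_neg n = odd_neg n * even_neg (Suc n)"
    "even_neg (Suc n) * odd_neg (Suc n) = odd_neg (Suc n) * even_neg (Suc n)"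
    by (fact *)+
qed

text \<open>Along an isotropic line no powers of q arise, so sums of exponents become products and
  inverses are again basis elements.\<close>

lemma iota_XX_powi:
  assumes "f 0 = 0" "\<And>m n. f (m + n) = f m + f n" "\<And>m n. Lambda (f m) (f n) = 0"
  shows "\<iota> (XX (f 1)) powi n = \<iota> (XX (f n))"
proof -
  have mult: "XX (f m) * XX (f n) = XX (f (m + n))" for m n
    by (simp add: XX_mult assms qh_0)
  have pow: "XX (f m) ^ k = XX (f (m * int k))" for m k
    by (induction k) (simp_all add: assms(1) XX_zero mult distrib_left)
  show ?thesis
  proof (cases "n \<ge> 0")
    case True
    then show ?thesis
      using pow[of 1 "nat n"] by (simp add: power_int_def iota_power[symmetric])
  next
    case False
    have "inverse (\<iota> (XX (f 1))) = \<iota> (XX (f (-1)))"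
      by (rule iota_inverse) (simp add: mult assms(1) XX_zero)
    then show ?thesis
      using False pow[of "-1" "nat (-n)"] by (simp add: power_int_def iota_power[symmetric])
  qed
qed

text \<open>The variables of a seed lie in the skew-field. Recording preimages in the torus allows
  the exchange relations to be checked there.\<close>

definition has_vars :: "'f quantum_seed \<Rightarrow> qtorus \<Rightarrow> qtorus \<Rightarrow> qtorus \<Rightarrow> bool" where
  "has_vars S v1 v2 v3 \<longleftrightarrow> vars S 1 = \<iota> v1 \<and> vars S 2 = \<iota> v2 \<and> vars S 3 = \<iota> v3 \<and>
     vars S 4 = \<iota> (ymon 1 0 0) \<and> vars S 5 = \<iota> (ymon 0 1 0) \<and> vars S 6 = \<iota> (ymon 0 0 1)"

lemma seed_monomial_eval:
  assumes f: "has_form S (a1, a2, a3) (b1, b2, b3) (c1, c2, c3)" and v: "has_vars S v1 v2 v3"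
  shows "seed_monomial \<iota> S e =
    \<iota> (qh (- (e 1 * (a1 * e 4 + a2 * e 5 + a3 * e 6) + e 2 * (b1 * e 4 + b2 * e 5 + b3 * e 6)
       + e 3 * (c1 * e 4 + c2 * e 5 + c3 * e 6))))
    * (\<iota> v1 powi e 1 * (\<iota> v2 powi e 2 * (\<iota> v3 powi e 3 * \<iota> (ymon (e 4) (e 5) (e 6)))))"
proof -
  let ?r = "\<lambda>i j. if i < j then e i * e j * form S i j else 0"
  let ?Q = "e 1 * (a1 * e 4 + a2 * e 5 + a3 * e 6) + e 2 * (b1 * e 4 + b2 * e 5 + b3 * e 6)
       + e 3 * (c1 * e 4 + c2 * e 5 + c3 * e 6)"
  have "(\<Sum>i\<in>{1..6}. \<Sum>j\<in>{i<..6}. e i * e j * form S i j) = (\<Sum>i\<in>{1..6}. \<Sum>j\<in>{1..6}. ?r i j)"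
  proof (rule sum.cong[OF refl])
    fix i :: nat
    assume "i \<in> {1..6}"
    then have "{i<..6} = {1..6} \<inter> {j. i < j}" by auto
    then show "(\<Sum>j\<in>{i<..6}. e i * e j * form S i j) = (\<Sum>j\<in>{1..6}. ?r i j)"
      by (simp only: sum.inter_restrict[OF finite_atLeastAtMost]) (simp add: mem_Collect_eq)
  qed
  also have "\<dots> = ?Q - (e 4 * e 5 + e 4 * e 6 + e 5 * e 6)"
    unfolding sum_1_6 using f unfolding has_form_def ball_1_6 by (simp add: algebra_simps)
  finally have q: "- (\<Sum>i\<in>{1..6}. \<Sum>j\<in>{i<..6}. e i * e j * form S i j)
      = - ?Q + (e 4 * e 5 + e 4 * e 6 + e 5 * e 6)" by simp
  have up: "[1..<7] = [1, 2, 3, 4, 5, 6 :: nat]"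
    by (simp add: upt_rec)
  have y: "\<iota> (ymon 1 0 0) powi n = \<iota> (ymon n 0 0)" "\<iota> (ymon 0 1 0) powi n = \<iota> (ymon 0 n 0)"
     "\<iota> (ymon 0 0 1) powi n = \<iota> (ymon 0 0 n)" for n
    by (rule iota_XX_powi; simp add: zero_prod_def Lambda_eval)+
  \<comment> \<open>The purely frozen part of the normalising power turns the ordered product of
    frozen powers into a basis element; only \<open>?Q\<close>, which mixes cluster and frozen
    indices, remains.\<close>
  have ymon: "qh (e 4 * e 5 + e 4 * e 6 + e 5 * e 6) * (ymon (e 4) 0 0 * (ymon 0 (e 5) 0 * ymon 0 0 (e 6)))
      = ymon (e 4) (e 5) (e 6)"
    by (simp add: torus_eval algebra_simps)
  have "seed_monomial \<iota> S e = \<iota> (qh (- ?Q + (e 4 * e 5 + e 4 * e 6 + e 5 * e 6)))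
    * (\<iota> v1 powi e 1 * (\<iota> v2 powi e 2 * (\<iota> v3 powi e 3 *
       \<iota> (ymon (e 4) 0 0 * (ymon 0 (e 5) 0 * ymon 0 0 (e 6))))))"
    using v unfolding seed_monomial_def q up has_vars_def by (simp add: y iota_mult)
  also have "\<dots> = \<iota> (qh (- ?Q)) * (\<iota> v1 powi e 1 * (\<iota> v2 powi e 2 * (\<iota> v3 powi e 3 *
       \<iota> (qh (e 4 * e 5 + e 4 * e 6 + e 5 * e 6) * (ymon (e 4) 0 0 * (ymon 0 (e 5) 0 * ymon 0 0 (e 6)))))))"
    unfolding qh_add[of "- ?Q"] iota_mult
    by (simp only: mult.assoc qh_left_commute_fractions[of "_ powi _"])
  finally show ?thesis
    unfolding ymon .
qed

lemma iota_nonzero: "v \<noteq> 0 \<Longrightarrow> \<iota> v \<noteq> 0"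
  using iota_eq_iff[of v 0] by (simp add: iota_zero)

text \<open>Replaces division in the skew-field by the exchange relation inside the torus.\<close>

lemma eq_inverse_mult:
  assumes "v \<noteq> 0" "v * v' = t"
  shows "inverse (\<iota> v) * \<iota> t = \<iota> v'"
  unfolding assms(2)[symmetric] iota_mult mult.assoc[symmetric]
  by (simp add: iota_nonzero assms(1))

lemma ymon_0: "ymon 0 0 0 = 1"
  using XX_zero by (simp add: zero_prod_def)

lemma next_vars:
  assumes f: "has_form S (a1, a2, a3) d2 d3" and b: "has_bmat S (g1, g2, g3) e2 e3"
    and g: "g1 \<ge> 0" "g2 \<ge> 0" "g3 \<ge> 0" and v: "has_vars S v1 v2 v3"
    and v1: "v1 \<noteq> 0" "v1 * v4 = v2 * v3 + qh (a1 * g1 + a2 * g2 + a3 * g3) * ymon g1 g2 g3"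
  shows "has_vars (next_seed \<iota> S) v2 v3 v4"
proof -
  obtain b1 b2 b3 c1 c2 c3 where d: "d2 = (b1, b2, b3)" "d3 = (c1, c2, c3)"
    by (cases d2, cases d3)
  have "vars (mutate \<iota> 1 S) 1 = inverse (\<iota> v1) * \<iota> (qh (a1 * g1 + a2 * g2 + a3 * g3) * ymon g1 g2 g3)
      + inverse (\<iota> v1) * \<iota> (v2 * v3)"
    using b g unfolding has_bmat_def ball_1_6
    by (cases e2; cases e3)
       (simp add: mutate_def seed_monomial_eval[OF f[unfolded d] v] ymon_0 qh_0 iota_one iota_mult
         qh_left_commute_fractions; simp add: algebra_simps)
  also have "\<dots> = \<iota> v4"
    unfolding distrib_left[symmetric] iota_add[symmetric]
    by (rule eq_inverse_mult) (simp_all add: v1 add.commute)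
  finally show ?thesis
    using v by (simp add: has_vars_def next_seed_def reorder_def) (simp add: mutate_def)
qed

lemma mult_inverse_commute:
  assumes "v1 * v3 = v3 * v1" "v2 * v3 = v3 * v2"
  shows "\<iota> v1 * (\<iota> v2 * inverse (\<iota> v3)) = inverse (\<iota> v3) * (\<iota> v1 * \<iota> v2)"
proof -
  have "\<iota> v * inverse (\<iota> v3) = inverse (\<iota> v3) * \<iota> v" if "v * v3 = v3 * v" for v
    using that mult_commute_imp_mult_inverse_commute[of "\<iota> v3" "\<iota> v"]
    by (simp add: iota_mult[symmetric])
  then show ?thesis
    using assms by (metis mult.assoc)
qed

text \<open>\<open>seed_monomial\<close> places the inverse of v3 after v1 and v2, so both have to
  commute with v3 before it can be moved to the front.\<close>

lemma prev_vars_neg: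
  assumes f: "has_form S d1 d2 (c1, c2, c3)" and b: "has_bmat S e1 e2 (-h1, -h2, -h3)"
    and h: "h1 \<ge> 0" "h2 \<ge> 0" "h3 \<ge> 0" and v: "has_vars S v1 v2 v3"
    and v3: "v3 \<noteq> 0" "v1 * v3 = v3 * v1" "v2 * v3 = v3 * v2"
      "v3 * v' = v1 * v2 + qh (c1 * h1 + c2 * h2 + c3 * h3) * ymon h1 h2 h3"
  shows "has_vars (prev_seed \<iota> S) v' v1 v2"
proof -
  obtain b1 b2 b3 a1 a2 a3 where d: "d1 = (a1, a2, a3)" "d2 = (b1, b2, b3)"
    by (cases d1, cases d2)
  have comm: "\<iota> v1 * (\<iota> v2 * inverse (\<iota> v3)) = inverse (\<iota> v3) * (\<iota> v1 * \<iota> v2)"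
    by (rule mult_inverse_commute) fact+
  have "vars (mutate \<iota> 3 S) 3 = inverse (\<iota> v3) * \<iota> (v1 * v2)
      + inverse (\<iota> v3) * \<iota> (qh (c1 * h1 + c2 * h2 + c3 * h3) * ymon h1 h2 h3)"
    using b h unfolding has_bmat_def ball_1_6
    by (cases e1; cases e2)
       (simp add: mutate_def seed_monomial_eval[OF f[unfolded d] v] ymon_0 qh_0 iota_one iota_mult
         qh_left_commute_fractions comm; simp add: algebra_simps)
  also have "\<dots> = \<iota> v'"
    unfolding distrib_left[symmetric] iota_add[symmetric]
    by (rule eq_inverse_mult) (simp_all add: v3)
  finally show ?thesis
    using v by (simp add: has_vars_def prev_seed_def reorder_def) (simp add: mutate_def)
qed

lemma prev_vars_pos:
  assumes f: "has_form S (a1, a2, a3) (b1, b2, b3) (c1, c2, c3)" and b: "has_bmat S e1 e2 (h1, h2, h3)"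
    and h: "h1 \<ge> 0" "h2 \<ge> 0" "h3 \<ge> 0" and v: "has_vars S v1 v2 v3"
    and v3: "v3 \<noteq> 0" "v1 * v3 = v3 * v1" "v2 * v3 = v3 * v2"
      "v3 * v' = qh ((c1 - a1 - b1) * h1 + (c2 - a2 - b2) * h2 + (c3 - a3 - b3) * h3)
         * (v1 * v2 * ymon h1 h2 h3) + 1"
  shows "has_vars (prev_seed \<iota> S) v' v1 v2"
proof -
  have "\<iota> v1 * (\<iota> v2 * inverse (\<iota> v3)) = inverse (\<iota> v3) * (\<iota> v1 * \<iota> v2)"
    by (rule mult_inverse_commute) fact+
  then have comm: "\<iota> v1 * (\<iota> v2 * (inverse (\<iota> v3) * x)) = inverse (\<iota> v3) * (\<iota> v1 * \<iota> v2 * x)" for x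
    by (simp only: mult.assoc[symmetric])
  have "vars (mutate \<iota> 3 S) 3 = inverse (\<iota> v3) * \<iota> (qh ((c1 - a1 - b1) * h1 + (c2 - a2 - b2) * h2 + (c3 - a3 - b3) * h3)
         * (v1 * v2 * ymon h1 h2 h3))
      + inverse (\<iota> v3) * \<iota> 1"
    using b h unfolding has_bmat_def ball_1_6
    by (cases e1; cases e2)
       (simp add: mutate_def seed_monomial_eval[OF f v] ymon_0 qh_0 iota_one iota_mult
         qh_left_commute_fractions comm; simp add: algebra_simps)
  also have "\<dots> = \<iota> v'"
    unfolding distrib_left[symmetric] iota_add[symmetric]
    by (rule eq_inverse_mult) (simp_all add: v3)
  finally show ?thesis
    using v by (simp add: has_vars_def prev_seed_def reorder_def) (simp add: mutate_def)
qed

definition has_data where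
  "has_data S v1 v2 v3 d1 d2 d3 g1 g2 g3 \<longleftrightarrow>
     has_form S d1 d2 d3 \<and> has_bmat S g1 g2 g3 \<and> has_vars S v1 v2 v3"

lemma next_data:
  assumes "has_data S v1 v2 v3 (a1, a2, a3) (b1, b2, b3) (c1, c2, c3) (g1, g2, g3) (k1, k2, k3) (l1, l2, l3)"
    and "g1 \<ge> 0" "g2 \<ge> 0" "g3 \<ge> 0"
    and "v1 \<noteq> 0" "v1 * v4 = v2 * v3 + qh (a1 * g1 + a2 * g2 + a3 * g3) * ymon g1 g2 g3"
  shows "has_data (next_seed \<iota> S) v2 v3 v4
     (b1, b2, b3) (c1, c2, c3) (b1 + c1 - a1, b2 + c2 - a2, b3 + c3 - a3)
     (g1 + k1, g2 + k2, g3 + k3) (g1 + l1, g2 + l2, g3 + l3) (- g1, - g2, - g3)"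
proof -
  from assms(1) have f: "has_form S (a1, a2, a3) (b1, b2, b3) (c1, c2, c3)"
    and b: "has_bmat S (g1, g2, g3) (k1, k2, k3) (l1, l2, l3)" and v: "has_vars S v1 v2 v3"
    by (simp_all add: has_data_def)
  show ?thesis
    unfolding has_data_def
    by (intro conjI next_form[OF f b] next_bmat[OF b] next_vars[OF f b _ _ _ v]) fact+
qed

lemma prev_data_neg:
  assumes "has_data S v1 v2 v3 (a1, a2, a3) (b1, b2, b3) (c1, c2, c3) (g1, g2, g3) (k1, k2, k3) (- h1, - h2, - h3)"
    and "h1 \<ge> 0" "h2 \<ge> 0" "h3 \<ge> 0"
    and "a1 * h1 + a2 * h2 + a3 * h3 = 0" "b1 * h1 + b2 * h2 + b3 * h3 = 0"
    and "v3 \<noteq> 0" "v1 * v3 = v3 * v1" "v2 * v3 = v3 * v2"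
    and "v3 * v' = v1 * v2 + qh (c1 * h1 + c2 * h2 + c3 * h3) * ymon h1 h2 h3"
  shows "has_data (prev_seed \<iota> S) v' v1 v2
     (h2 + h3 - c1, h3 - h1 - c2, - h1 - h2 - c3) (a1, a2, a3) (b1, b2, b3)
     (h1, h2, h3) (g1 - h1, g2 - h2, g3 - h3) (k1 - h1, k2 - h2, k3 - h3)"
proof -
  from assms(1) have f: "has_form S (a1, a2, a3) (b1, b2, b3) (c1, c2, c3)"
    and b: "has_bmat S (g1, g2, g3) (k1, k2, k3) (- h1, - h2, - h3)" and v: "has_vars S v1 v2 v3"
    by (simp_all add: has_data_def)
  show ?thesis
    unfolding has_data_def
    by (intro conjI prev_form_neg[OF f b] prev_bmat_neg[OF b] prev_vars_neg[OF f b _ _ _ v]) fact+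
qed

lemma prev_data_pos:
  assumes "has_data S v1 v2 v3 (a1, a2, a3) (b1, b2, b3) (c1, c2, c3) (g1, g2, g3) (k1, k2, k3) (h1, h2, h3)"
    and "h1 \<ge> 0" "h2 \<ge> 0" "h3 \<ge> 0"
    and "v3 \<noteq> 0" "v1 * v3 = v3 * v1" "v2 * v3 = v3 * v2"
    and "v3 * v' = qh ((c1 - a1 - b1) * h1 + (c2 - a2 - b2) * h2 + (c3 - a3 - b3) * h3)
         * (v1 * v2 * ymon h1 h2 h3) + 1"
  shows "has_data (prev_seed \<iota> S) v' v1 v2
     (- c1, - c2, - c3) (a1, a2, a3) (b1, b2, b3)
     (- h1, - h2, - h3) (g1, g2, g3) (k1, k2, k3)"
proof -
  from assms(1) have f: "has_form S (a1, a2, a3) (b1, b2, b3) (c1, c2, c3)"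
    and b: "has_bmat S (g1, g2, g3) (k1, k2, k3) (h1, h2, h3)" and v: "has_vars S v1 v2 v3"
    by (simp_all add: has_data_def)
  show ?thesis
    unfolding has_data_def
    by (intro conjI prev_form_pos[OF f b] prev_bmat_pos[OF b] prev_vars_pos[OF f b _ _ _ v]) fact+
qed

section \<open>The seeds Sigma_m in terms of the four sequences\<close>

lemma initial_data:
  "has_data (initial_seed \<iota>) (XX (1, 0, 0, 0, 0, 0)) (XX (0, 1, 0, 0, 0, 0)) (XX (0, 0, 1, 0, 0, 0))
     (-1, 0, 0) (0, -1, 0) (0, 0, -1) (1, 0, 0) (0, 1, 0) (0, 0, 1)"
  unfolding has_data_def has_form_def has_bmat_def has_vars_def ball_1_6
  by (simp add: initial_seed_def lam0_def B0_def unit_expo_def)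

lemma Sigma_seed_1: "Sigma_seed \<iota> 1 = initial_seed \<iota>"
  by (simp add: Sigma_seed_def)

lemma Sigma_seed_next: "m \<ge> 1 \<Longrightarrow> Sigma_seed \<iota> (m + 1) = next_seed \<iota> (Sigma_seed \<iota> m)"
proof -
  assume "m \<ge> 1"
  then have "nat (m + 1 - 1) = Suc (nat (m - 1))" by simp
  with \<open>m \<ge> 1\<close> show ?thesis by (simp add: Sigma_seed_def)
qed

text \<open>The definition switches branches at m = 1, where both give the initial seed.\<close>

lemma Sigma_seed_prev: "m \<le> 1 \<Longrightarrow> Sigma_seed \<iota> (m - 1) = prev_seed \<iota> (Sigma_seed \<iota> m)"
proof -
  assume "m \<le> 1"
  then have "nat (1 - (m - 1)) = Suc (nat (1 - m))" by simp
  with \<open>m \<le> 1\<close> show ?thesis by (cases "m = 1") (simp_all add: Sigma_seed_def)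
qed

lemma neg_numeral_diff: "- 1 - x = - x - (1::int)" "- numeral n - x = - x - (numeral n :: int)"
  by simp_all

lemma Sigma_pos_even:
  assumes "has_data (Sigma_seed \<iota> (2 * int k + 1)) (odd_pos k) (even_pos k) (odd_pos (Suc k))
     (int k - 1, 0, - int k) (int k, -1, - int k) (int k, 0, - int k - 1)
     (int k + 1, int k, int k) (0, 1, 0) (- int k, - int k, 1 - int k)"
  shows "has_data (Sigma_seed \<iota> (2 * int k + 2)) (even_pos k) (odd_pos (Suc k)) (even_pos (Suc k))
     (int k, -1, - int k) (int k, 0, - int k - 1) (int k + 1, -1, - int k - 1)
     (int k + 1, int k + 1, int k) (1, 0, 1) (- int k - 1, - int k, - int k)"
proof -
  \<comment> \<open>The pairing of the degree with the c-vector is the constant exponent in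
    \<open>exchange_odd_pos\<close>; here seed mutation and the chain relation meet.\<close>
  have "(int k - 1) * (int k + 1) + 0 * int k + - int k * int k = - 1"
    by (simp add: algebra_simps)
  then have "odd_pos k * even_pos (Suc k) = even_pos k * odd_pos (Suc k)
      + qh ((int k - 1) * (int k + 1) + 0 * int k + - int k * int k) * ymon (int k + 1) (int k) (int k)"
    by (simp only: exchange_odd_pos pos_commute)
  from next_data[OF assms _ _ _ odd_pos_nonzero this] show ?thesis
    using Sigma_seed_next[of "2 * int k + 1"] by (simp add: algebra_simps neg_numeral_diff)
qed

lemma Sigma_pos_odd:
  assumes "has_data (Sigma_seed \<iota> (2 * int k + 2)) (even_pos k) (odd_pos (Suc k)) (even_pos (Suc k))
     (int k, -1, - int k) (int k, 0, - int k - 1) (int k + 1, -1, - int k - 1)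
     (int k + 1, int k + 1, int k) (1, 0, 1) (- int k - 1, - int k, - int k)"
  shows "has_data (Sigma_seed \<iota> (2 * int (Suc k) + 1)) (odd_pos (Suc k)) (even_pos (Suc k)) (odd_pos (Suc (Suc k)))
     (int k, 0, - int k - 1) (int k + 1, -1, - int k - 1) (int k + 1, 0, - int k - 2)
     (int k + 2, int k + 1, int k + 1) (0, 1, 0) (- int k - 1, - int k - 1, - int k)"
proof -
  have "int k * (int k + 1) + - 1 * (int k + 1) + - int k * int k = - 1"
    by (simp add: algebra_simps)
  then have "even_pos k * odd_pos (Suc (Suc k)) = odd_pos (Suc k) * even_pos (Suc k)
      + qh (int k * (int k + 1) + - 1 * (int k + 1) + - int k * int k) * ymon (int k + 1) (int k + 1) (int k)"
    by (simp only: exchange_even_pos pos_commute)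
  from next_data[OF assms _ _ _ even_pos_nonzero this] show ?thesis
    using Sigma_seed_next[of "2 * int k + 2"] by (simp add: algebra_simps neg_numeral_diff)
qed

text \<open>The rows of the form are the degrees in \<open>odd_pos_degree\<close> and
  \<open>even_pos_degree\<close>. The c-vectors are (1,0,0) + k(1,1,1), (0,1,0) and (0,0,1) -
  k(1,1,1).\<close>

lemma Sigma_pos:
  "has_data (Sigma_seed \<iota> (2 * int k + 1)) (odd_pos k) (even_pos k) (odd_pos (Suc k))
     (int k - 1, 0, - int k) (int k, -1, - int k) (int k, 0, - int k - 1)
     (int k + 1, int k, int k) (0, 1, 0) (- int k, - int k, 1 - int k)"
proof (induction k)
  case 0
  show ?case
    using initial_data by (simp add: Sigma_seed_1 odd_pos_def even_pos_def)
next
  case (Suc k)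
  show ?case
    using Sigma_pos_odd[OF Sigma_pos_even[OF Suc]] by (simp add: algebra_simps neg_numeral_diff)
qed

lemma Sigma_neg_odd:
  assumes "has_data (Sigma_seed \<iota> (- 2 * int k - 2)) (even_neg (Suc (Suc k))) (odd_neg (Suc k)) (even_neg (Suc k))
     (int k + 1, 0, - int k) (int k, 1, - int k) (int k, 0, 1 - int k)
     (int k - 1, int k, int k) (0, -1, 0) (- int k, - int k, - (int k + 1))"
  shows "has_data (Sigma_seed \<iota> (- 2 * int k - 3)) (odd_neg (Suc (Suc k))) (even_neg (Suc (Suc k))) (odd_neg (Suc k))
     (int k + 1, 1, - int k - 1) (int k + 1, 0, - int k) (int k, 1, - int k)
     (int k, int k, int k + 1) (-1, 0, -1) (- int k, - (int k + 1), - (int k + 1))"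
proof -
  have "int k * int k + 0 * int k + (1 - int k) * (int k + 1) = 1"
    by (simp add: algebra_simps)
  then have e: "even_neg (Suc k) * odd_neg (Suc (Suc k)) = even_neg (Suc (Suc k)) * odd_neg (Suc k)
      + qh (int k * int k + 0 * int k + (1 - int k) * (int k + 1)) * ymon (int k) (int k) (int k + 1)"
    by (simp only: exchange_even_neg) (simp add: algebra_simps)
  \<comment> \<open>The vectors are left unsimplified, in the shape that
    \<open>prev_data_neg\<close> produces, so that the rule unifies.\<close>
  have "has_data (prev_seed \<iota> (Sigma_seed \<iota> (- 2 * int k - 2)))
      (odd_neg (Suc (Suc k))) (even_neg (Suc (Suc k))) (odd_neg (Suc k))
     (int k + (int k + 1) - int k, int k + 1 - int k - 0, - int k - int k - (1 - int k)) (int k + 1, 0, - int k) (int k, 1, - int k)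
     (int k, int k, int k + 1) (int k - 1 - int k, int k - int k, int k - (int k + 1)) (0 - int k, -1 - int k, 0 - (int k + 1))"
    by (rule prev_data_neg[OF assms _ _ _ _ _ even_neg_nonzero _ _ e])
       (simp_all add: even_neg_commute neg_commute algebra_simps)
  then show ?thesis
    using Sigma_seed_prev[of "- 2 * int k - 2"] by (simp add: algebra_simps neg_numeral_diff)
qed

lemma Sigma_neg_even:
  assumes "has_data (Sigma_seed \<iota> (- 2 * int k - 3)) (odd_neg (Suc (Suc k))) (even_neg (Suc (Suc k))) (odd_neg (Suc k))
     (int k + 1, 1, - int k - 1) (int k + 1, 0, - int k) (int k, 1, - int k)
     (int k, int k, int k + 1) (-1, 0, -1) (- int k, - (int k + 1), - (int k + 1))"
  shows "has_data (Sigma_seed \<iota> (- 2 * int (Suc k) - 2)) (even_neg (Suc (Suc (Suc k)))) (odd_neg (Suc (Suc k))) (even_neg (Suc (Suc k)))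
     (int k + 2, 0, - int k - 1) (int k + 1, 1, - int k - 1) (int k + 1, 0, - int k)
     (int k, int k + 1, int k + 1) (0, -1, 0) (- int k - 1, - int k - 1, - (int k + 2))"
proof -
  have "int k * int k + 1 * (int k + 1) + - int k * (int k + 1) = 1"
    by (simp add: algebra_simps)
  then have e: "odd_neg (Suc k) * even_neg (Suc (Suc (Suc k))) = odd_neg (Suc (Suc k)) * even_neg (Suc (Suc k))
      + qh (int k * int k + 1 * (int k + 1) + - int k * (int k + 1)) * ymon (int k) (int k + 1) (int k + 1)"
    by (simp only: exchange_odd_neg) (simp add: algebra_simps)
  have "has_data (prev_seed \<iota> (Sigma_seed \<iota> (- 2 * int k - 3)))
      (even_neg (Suc (Suc (Suc k)))) (odd_neg (Suc (Suc k))) (even_neg (Suc (Suc k)))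
     (int k + 1 + (int k + 1) - int k, int k + 1 - int k - 1, - int k - (int k + 1) - (- int k))
     (int k + 1, 1, - int k - 1) (int k + 1, 0, - int k)
     (int k, int k + 1, int k + 1) (int k - int k, int k - (int k + 1), int k + 1 - (int k + 1))
     (- 1 - int k, 0 - (int k + 1), - 1 - (int k + 1))"
    by (rule prev_data_neg[OF assms _ _ _ _ _ odd_neg_nonzero _ _ e])
       (simp_all add: odd_neg_commute neg_commute algebra_simps)
  then show ?thesis
    using Sigma_seed_prev[of "- 2 * int k - 3"] by (simp add: algebra_simps neg_numeral_diff)
qed

text \<open>The first three backward mutations meet nonnegative c-vectors and need
  \<open>prev_data_pos\<close>. After them all c-vectors are nonpositive and the regular pattern
  begins.\<close>

lemma Sigma_0:
  "has_data (Sigma_seed \<iota> 0) X0_elt (XX (1, 0, 0, 0, 0, 0)) (XX (0, 1, 0, 0, 0, 0))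
     (0, 0, 1) (-1, 0, 0) (0, -1, 0) (0, 0, -1) (1, 0, 0) (0, 1, 0)"
proof -
  have "has_data (prev_seed \<iota> (initial_seed \<iota>)) X0_elt (XX (1, 0, 0, 0, 0, 0)) (XX (0, 1, 0, 0, 0, 0))
     (- 0, - 0, - (-1)) (-1, 0, 0) (0, -1, 0) (- 0, - 0, - 1) (1, 0, 0) (0, 1, 0)"
    by (rule prev_data_pos[OF initial_data])
       (simp_all add: elt_defs one_monom torus_eval odd_pos_nonzero[of "Suc 0", unfolded odd_pos_def, simplified, unfolded XX_monom])
  then show ?thesis
    using Sigma_seed_prev[of 1] by (simp add: Sigma_seed_1)
qed

lemma Sigma_minus_1:
  "has_data (Sigma_seed \<iota> (-1)) Xm1_elt X0_elt (XX (1, 0, 0, 0, 0, 0))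
     (0, 1, 0) (0, 0, 1) (-1, 0, 0) (0, -1, 0) (0, 0, -1) (1, 0, 0)"
proof -
  have "has_data (prev_seed \<iota> (Sigma_seed \<iota> 0)) Xm1_elt X0_elt (XX (1, 0, 0, 0, 0, 0))
     (- 0, - (-1), - 0) (0, 0, 1) (-1, 0, 0) (- 0, - 1, - 0) (0, 0, -1) (1, 0, 0)"
    by (rule prev_data_pos[OF Sigma_0])
       (simp_all add: elt_defs one_monom torus_eval even_pos_nonzero[of 0, unfolded even_pos_def, simplified, unfolded XX_monom])
  then show ?thesis
    using Sigma_seed_prev[of 0] by simp
qed

lemma Sigma_minus_2:
  "has_data (Sigma_seed \<iota> (-2)) (even_neg (Suc (Suc 0))) Xm1_elt X0_elt
     (1, 0, 0) (0, 1, 0) (0, 0, 1) (-1, 0, 0) (0, -1, 0) (0, 0, -1)"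
proof -
  have "has_data (prev_seed \<iota> (Sigma_seed \<iota> (-1))) (even_neg (Suc (Suc 0))) Xm1_elt X0_elt
     (- (-1), - 0, - 0) (0, 1, 0) (0, 0, 1) (- 1, - 0, - 0) (0, -1, 0) (0, 0, -1)"
    by (rule prev_data_pos[OF Sigma_minus_1])
       (simp_all add: elt_defs even_neg_def u1_elt_eval one_monom torus_eval odd_pos_nonzero[of 0, unfolded odd_pos_def, simplified, unfolded XX_monom])
  then show ?thesis
    using Sigma_seed_prev[of "-1"] by simp
qed

lemma Sigma_neg:
  "has_data (Sigma_seed \<iota> (- 2 * int k - 2)) (even_neg (Suc (Suc k))) (odd_neg (Suc k)) (even_neg (Suc k))
     (int k + 1, 0, - int k) (int k, 1, - int k) (int k, 0, 1 - int k)
     (int k - 1, int k, int k) (0, -1, 0) (- int k, - int k, - (int k + 1))"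
proof (induction k)
  case 0
  show ?case
    using Sigma_minus_2 by (simp add: odd_neg_def even_neg_def)
next
  case (Suc k)
  show ?case
    using Sigma_neg_even[OF Sigma_neg_odd[OF Suc]] by (simp add: algebra_simps neg_numeral_diff)
qed

text \<open>Combines \<open>chain_formula\<close> and \<open>chain_one\<close>. Here t is the factor
  beside u in the second sum of the theorem, up to powers of y_1 y_2 y_3, and e is the power of q
  relating it to \<open>dlt\<close> times the entry 0.\<close>

lemma chain_iota_formula:
  assumes n: "n > 0" and y: "y_degree y a b c" and t: "y_degree t a' b' c'" and x: "dlt * x = qh e * t"
  shows "\<iota> (chain x y (Suc n)) =
    (\<Sum>l = 0..n div 2. \<iota> (qh ((3 - 2 * (a + b + c)) * int l)) * \<iota> (u_elt (n - 2 * l)) * \<iota> y * \<iota> (qh (-3) * dlt) ^ l) -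
    (\<Sum>l = 0..(n - 1) div 2. \<iota> (qh ((3 - 2 * (a' + b' + c')) * int l + e)) * \<iota> (u_elt (n - 1 - 2 * l)) * \<iota> t * \<iota> (qh (-3) * dlt) ^ l)"
proof -
  obtain m where m: "n = Suc m"
    using n by (cases n) auto
  have "qh ((3 - 2 * (a' + b' + c')) * int l + e) * U * t * (qh (-3) * dlt) ^ l = U * dlt ^ l * (qh e * t)" for l U
    unfolding qh_left_commute y_power_collect[OF t, symmetric] add.commute[of _ e] qh_add
    by (simp only: mult.assoc)
  then show ?thesis
    unfolding m chain_formula chain_one iota_power[symmetric] iota_mult[symmetric] iota_sum[symmetric] iota_diff[symmetric] iota_eq_iff
    by (simp only: y_power_collect[OF y] sum_distrib_right x diff_Suc_1)
qed

section \<open>Membership in the quantum cluster algebra\<close>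

abbreviation QCA where "QCA \<equiv> quantum_cluster_algebra \<iota>"

lemma mutate_var: "vars (mutate \<iota> k S) k =
    seed_monomial \<iota> S (\<lambda>i. - of_bool (i = k) + max (bmat S i k) 0) +
    seed_monomial \<iota> S (\<lambda>i. - of_bool (i = k) + max (- bmat S i k) 0)"
  by (simp add: mutate_def)

lemma initial_reachable: "k \<in> {1, 2, 3} \<Longrightarrow> mutate \<iota> k (initial_seed \<iota>) \<in> reachable_seeds \<iota>"
  by (intro reachable_seeds.intros)

lemma initial_form: "has_form (initial_seed \<iota>) (-1, 0, 0) (0, -1, 0) (0, 0, -1)"
  and initial_vars: "has_vars (initial_seed \<iota>) (XX (1, 0, 0, 0, 0, 0)) (XX (0, 1, 0, 0, 0, 0)) (XX (0, 0, 1, 0, 0, 0))"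
  using initial_data by (simp_all add: has_data_def)

lemma X123_in_QCA:
  "\<iota> (XX (1, 0, 0, 0, 0, 0)) \<in> QCA" "\<iota> (XX (0, 1, 0, 0, 0, 0)) \<in> QCA" "\<iota> (XX (0, 0, 1, 0, 0, 0)) \<in> QCA"
  using quantum_cluster_algebra.cluster_variable[OF reachable_seeds.initial[of \<iota>], of 1]
    quantum_cluster_algebra.cluster_variable[OF reachable_seeds.initial[of \<iota>], of 2]
    quantum_cluster_algebra.cluster_variable[OF reachable_seeds.initial[of \<iota>], of 3] initial_vars
  by (simp_all add: has_vars_def)

lemma mutate_1_var: "vars (mutate \<iota> 1 (initial_seed \<iota>)) 1 = \<iota> X4_elt"
proof -
  have "has_data (Sigma_seed \<iota> 2) (even_pos 0) (odd_pos (Suc 0)) (even_pos (Suc 0))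
     (0, -1, 0) (0, 0, -1) (1, -1, -1) (1, 1, 0) (1, 0, 1) (-1, 0, 0)"
    using Sigma_pos_even[OF Sigma_pos[of 0]] by simp
  then have "vars (next_seed \<iota> (initial_seed \<iota>)) 3 = \<iota> X4_elt"
    using Sigma_seed_next[of 1] by (simp add: has_data_def has_vars_def even_pos_def Sigma_seed_1)
  then show ?thesis
    by (simp add: next_seed_def reorder_def)
qed

lemma mutate_3_var: "vars (mutate \<iota> 3 (initial_seed \<iota>)) 3 = \<iota> X0_elt"
proof -
  have "vars (prev_seed \<iota> (initial_seed \<iota>)) 1 = \<iota> X0_elt"
    using Sigma_0 Sigma_seed_prev[of 1] by (simp add: has_data_def has_vars_def Sigma_seed_1)
  then show ?thesis
    by (simp add: prev_seed_def reorder_def)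
qed

lemma mutate_1_form: "has_form (mutate \<iota> 1 (initial_seed \<iota>)) (1, -1, -1) (0, -1, 0) (0, 0, -1)"
proof -
  have m: "i \<in> {1..6} \<Longrightarrow> j \<in> {1..6} \<Longrightarrow> form (mutate \<iota> 1 (initial_seed \<iota>)) i j =
     mutate_form (form (initial_seed \<iota>)) B0 1 i j" for i j
    by (simp add: mutate_def initial_seed_def)
  show ?thesis
    unfolding has_form_def ball_1_6
    by (simp add: m[unfolded One_nat_def] mutate_has_form[OF initial_form, unfolded One_nat_def]
        sum_1_6[unfolded One_nat_def] mutation_matrix_def B0_def)
qed

lemma mutate_3_form: "has_form (mutate \<iota> 3 (initial_seed \<iota>)) (-1, 0, 0) (0, -1, 0) (0, 0, 1)"
proof -
  have m: "i \<in> {1..6} \<Longrightarrow> j \<in> {1..6} \<Longrightarrow> form (mutate \<iota> 3 (initial_seed \<iota>)) i j =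
     mutate_form (form (initial_seed \<iota>)) B0 3 i j" for i j
    by (simp add: mutate_def initial_seed_def)
  show ?thesis
    unfolding has_form_def ball_1_6
    by (simp add: m[unfolded One_nat_def] mutate_has_form[OF initial_form, unfolded One_nat_def]
        sum_1_6[unfolded One_nat_def] mutation_matrix_def B0_def)
qed

lemma mutate_1_vars: "has_vars (mutate \<iota> 1 (initial_seed \<iota>)) X4_elt (XX (0, 1, 0, 0, 0, 0)) (XX (0, 0, 1, 0, 0, 0))"
  using initial_vars mutate_1_var unfolding has_vars_def by (simp add: mutate_def)

lemma mutate_3_vars: "has_vars (mutate \<iota> 3 (initial_seed \<iota>)) (XX (1, 0, 0, 0, 0, 0)) (XX (0, 1, 0, 0, 0, 0)) X0_elt"
  using initial_vars mutate_3_var unfolding has_vars_def by (simp add: mutate_def)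

lemma inverse_X23:
  "inverse (\<iota> (XX (0, 1, 0, 0, 0, 0))) = \<iota> (XX (0, -1, 0, 0, 0, 0))"
  "inverse (\<iota> (XX (0, 0, 1, 0, 0, 0))) = \<iota> (XX (0, 0, -1, 0, 0, 0))"
  by (rule iota_inverse, simp add: torus_eval one_monom)+

lemma X4_in_QCA: "\<iota> X4_elt \<in> QCA"
  using quantum_cluster_algebra.cluster_variable[OF initial_reachable[of 1], of 1] mutate_1_var by simp

lemma X0_in_QCA: "\<iota> X0_elt \<in> QCA"
  using quantum_cluster_algebra.cluster_variable[OF initial_reachable[of 3], of 3] mutate_3_var by simp

lemma w_in_QCA: "\<iota> w_elt \<in> QCA"
proof -
  have "vars (mutate \<iota> 2 (initial_seed \<iota>)) 2 = \<iota> w_elt"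
    unfolding mutate_var seed_monomial_eval[OF initial_form initial_vars]
    by (simp add: initial_seed_def B0_def inverse_X23 iota_mult[symmetric] iota_add[symmetric]
        iota_eq_iff w_elt_def ymon_0 qh_0 iota_one)
       (simp add: torus_eval)
  then show ?thesis
    using quantum_cluster_algebra.cluster_variable[OF initial_reachable[of 2], of 2] by simp
qed

lemma z_in_QCA: "\<iota> z_elt \<in> QCA"
proof -
  let ?S = "mutate \<iota> 1 (initial_seed \<iota>)"
  have b: "bmat ?S 1 3 = -1" "bmat ?S 2 3 = 1" "bmat ?S 3 3 = 0"
    "bmat ?S 4 3 = 1" "bmat ?S 5 3 = 0" "bmat ?S 6 3 = 1"
    by (simp_all add: mutate_def mutate_bmat_def initial_seed_def B0_def)
  have "vars (mutate \<iota> 3 ?S) 3 = \<iota> z_elt"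
    unfolding mutate_var seed_monomial_eval[OF mutate_1_form mutate_1_vars]
    by (simp add: b[unfolded One_nat_def] inverse_X23 iota_mult[symmetric] iota_add[symmetric]
        iota_eq_iff z_elt_def ymon_0 qh_0 iota_one)
       (simp add: torus_eval elt_defs)
  then show ?thesis
    using quantum_cluster_algebra.cluster_variable[OF reachable_seeds.mutation[OF initial_reachable[of 1], of 3], of 3] by simp
qed

text \<open>Reachable seeds are not reordered: the third place of Sigma_0, where X_(-1) arises, is
  place 2 after the initial mutation in direction 3.\<close>

lemma Xm1_in_QCA: "\<iota> Xm1_elt \<in> QCA"
proof -
  let ?S = "mutate \<iota> 3 (initial_seed \<iota>)"
  have b: "bmat ?S 1 2 = 1" "bmat ?S 2 2 = 0" "bmat ?S 3 2 = 1"
    "bmat ?S 4 2 = 0" "bmat ?S 5 2 = 1" "bmat ?S 6 2 = 0"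
    by (simp_all add: mutate_def mutate_bmat_def initial_seed_def B0_def)
  have "vars (mutate \<iota> 2 ?S) 2 = \<iota> Xm1_elt"
    unfolding mutate_var seed_monomial_eval[OF mutate_3_form mutate_3_vars]
    by (simp add: b[unfolded One_nat_def] inverse_X23 iota_mult[symmetric] iota_add[symmetric]
        iota_eq_iff ymon_0 qh_0 iota_one)
       (simp add: torus_eval elt_defs)
  then show ?thesis
    using quantum_cluster_algebra.cluster_variable[OF reachable_seeds.mutation[OF initial_reachable[of 3], of 2], of 2] by simp
qed

lemma u1_in_QCA: "\<iota> u1_elt \<in> QCA"
  unfolding u1_elt_def iota_diff iota_mult
  by (intro quantum_cluster_algebra.intros w_in_QCA z_in_QCA)

text \<open>Only the starting values have to be found in the algebra; the recursion does the rest,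
  without relating the reordered Sigma_m to reachable seeds.\<close>

lemma chain_in_QCA: "\<iota> x \<in> QCA \<Longrightarrow> \<iota> y \<in> QCA \<Longrightarrow> \<iota> (chain x y n) \<in> QCA"
  by (induction n rule: induct_nat_012)
     (simp_all add: iota_diff iota_mult quantum_cluster_algebra.intros u1_in_QCA)

lemma chains_in_QCA:
  "\<iota> (odd_pos n) \<in> QCA" "\<iota> (even_pos n) \<in> QCA" "\<iota> (even_neg n) \<in> QCA" "\<iota> (odd_neg n) \<in> QCA"
proof -
  \<comment> \<open>The formal entries 0 are initial variables times inverse frozen monomials, which
    the algebra contains.\<close>
  have "monom 0 (0, 1, 0, -1, -1, 0) = qh (-1) * (XX (0, 1, 0, 0, 0, 0) * ymon (-1) (-1) 0)"
    "monom 0 (1, 0, 0, -1, 0, 0) = qh (-1) * (XX (1, 0, 0, 0, 0, 0) * ymon (-1) 0 0)"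
    by (simp_all add: torus_eval)
  then have "\<iota> (monom 0 (0, 1, 0, -1, -1, 0)) \<in> QCA" "\<iota> (monom 0 (1, 0, 0, -1, 0, 0)) \<in> QCA"
    by (simp_all add: iota_mult quantum_cluster_algebra.intros X123_in_QCA)
  then show "\<iota> (odd_pos n) \<in> QCA" "\<iota> (even_pos n) \<in> QCA" "\<iota> (even_neg n) \<in> QCA" "\<iota> (odd_neg n) \<in> QCA"
    unfolding odd_pos_def even_pos_def even_neg_def odd_neg_def
    by (simp_all add: chain_in_QCA X123_in_QCA X4_in_QCA X0_in_QCA Xm1_in_QCA)
qed

section \<open>Formulas for the variables\<close>

lemma Xvar_odd_pos: "Xvar \<iota> (2 * int n + 1) = \<iota> (odd_pos n)"
  using Sigma_pos[of n] by (simp add: Xvar_def has_data_def has_vars_def)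

lemma Xvar_even_pos: "Xvar \<iota> (2 * int n + 2) = \<iota> (even_pos n)"
  using Sigma_pos_even[OF Sigma_pos[of n]] by (simp add: Xvar_def has_data_def has_vars_def)

text \<open>The index is shifted by one because entry 0 is only formal; n = 0 is separate since
  \<open>Sigma_neg\<close> starts at Sigma_(-2).\<close>

lemma Xvar_even_neg: "Xvar \<iota> (- 2 * int n) = \<iota> (even_neg (Suc n))"
proof (cases n)
  case 0
  then show ?thesis
    using Sigma_0 by (simp add: Xvar_def has_data_def has_vars_def even_neg_def)
next
  case (Suc k)
  then have eq: "- 2 * int n = - 2 * int k - 2" by simp
  show ?thesis
    unfolding eq unfolding Suc using Sigma_neg[of k] by (simp add: Xvar_def has_data_def has_vars_def)
qed

lemma Xvar_odd_neg: "Xvar \<iota> (- 2 * int n - 1) = \<iota> (odd_neg (Suc n))"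
proof (cases n)
  case 0
  then show ?thesis
    using Sigma_minus_1 by (simp add: Xvar_def has_data_def has_vars_def odd_neg_def)
next
  case (Suc k)
  then have eq: "- 2 * int n - 1 = - 2 * int k - 3" by simp
  show ?thesis
    unfolding eq unfolding Suc using Sigma_neg_odd[OF Sigma_neg[of k]] by (simp add: Xvar_def has_data_def has_vars_def)
qed

end

theorem corollary3p8:
  fixes \<iota> :: "qtorus \<Rightarrow> 'f::division_ring" and n :: nat
  defines "q2 \<equiv> \<lambda>a::int. \<iota> (qh a)"
    and "u \<equiv> \<lambda>k. \<iota> (u_elt k)"
    and "X \<equiv> Xvar \<iota>"
    and "y \<equiv> yvar \<iota>"
  assumes "skew_field_of_fractions \<iota>" and "n > 0"
  shows
    "{X (2 * int n + 3), X (2 * int n + 4), X (- (2 * int n)), X (- (2 * int n + 1))}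
       \<subseteq> quantum_cluster_algebra \<iota>
     \<and> X (2 * int n + 3) =
         (\<Sum>l = 0..n div 2. q2 (5 * int l) * u (n - 2 * l) * X 3 * (y 1 * y 2 * y 3) ^ l) -
         (\<Sum>l = 0..(n - 1) div 2.
            q2 (5 * (int l + 1)) * u (n - 1 - 2 * l) * X 1 * (y 1 * y 2 * y 3) ^ (l + 1))
     \<and> X (2 * int n + 4) =
         (\<Sum>l = 0..n div 2. q2 (5 * int l) * u (n - 2 * l) * X 4 * (y 1 * y 2 * y 3) ^ l) -
         (\<Sum>l = 0..(n - 1) div 2.
            q2 (5 * (int l + 1)) * u (n - 1 - 2 * l) * X 2 * (y 1 * y 2 * y 3) ^ (l + 1))
     \<and> X (- (2 * int n)) =
         (\<Sum>l = 0..n div 2. q2 (int l) * u (n - 2 * l) * X 0 * (y 1 * y 2 * y 3) ^ l) -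
         (\<Sum>l = 0..(n - 1) div 2.
            q2 (int l - 1) * u (n - 1 - 2 * l) * X 2 * y 3 * (y 1 * y 2 * y 3) ^ l)
     \<and> X (- (2 * int n + 1)) =
         (\<Sum>l = 0..n div 2. q2 (int l) * u (n - 2 * l) * X (- 1) * (y 1 * y 2 * y 3) ^ l) -
         (\<Sum>l = 0..(n - 1) div 2.
            q2 (int l) * u (n - 1 - 2 * l) * X 1 * y 2 * y 3 * (y 1 * y 2 * y 3) ^ l)"
proof -
  interpret torus_fractions \<iota>
    by unfold_locales fact
  \<comment> \<open>Each of the three pairs of frozen variables contributes q^(-1/2).\<close>
  have y: "y 1 * y 2 * y 3 = \<iota> (qh (-3) * dlt)"
    unfolding y_def yvar_def iota_mult[symmetric] iota_eq_iff by (simp add: unit_expo_def torus_eval)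
  have y2: "y 2 = \<iota> (ymon 0 1 0)" and y3: "y 3 = \<iota> (ymon 0 0 1)"
    by (simp_all add: y_def yvar_def unit_expo_def)
  have X: "X (2 * int n + 3) = \<iota> (odd_pos (Suc n))" "X (2 * int n + 4) = \<iota> (even_pos (Suc n))"
    "X (- (2 * int n)) = \<iota> (even_neg (Suc n))" "X (- (2 * int n + 1)) = \<iota> (odd_neg (Suc n))"
    using Xvar_odd_pos[of "Suc n"] Xvar_even_pos[of "Suc n"] Xvar_even_neg[of n] Xvar_odd_neg[of n]
    by (simp_all add: X_def algebra_simps neg_numeral_diff)
  have x: "X 1 = \<iota> (XX (1, 0, 0, 0, 0, 0))" "X 2 = \<iota> (XX (0, 1, 0, 0, 0, 0))"
    "X 3 = \<iota> (XX (0, 0, 1, 0, 0, 0))" "X 4 = \<iota> X4_elt" "X 0 = \<iota> X0_elt" "X (- 1) = \<iota> Xm1_elt"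
    using Xvar_odd_pos[of 0] Xvar_even_pos[of 0] Xvar_odd_pos[of 1] Xvar_even_pos[of 1]
      Xvar_even_neg[of 0] Xvar_odd_neg[of 0]
    by (simp_all add: X_def odd_pos_def even_pos_def even_neg_def odd_neg_def)
  have deg: "y_degree X0_elt 0 0 1" "y_degree X4_elt 1 (-1) (-1)" "y_degree Xm1_elt 0 1 0"
    unfolding elt_defs by (intro y_degree_add y_degree_XX; simp)+
  have deg_X: "y_degree (XX (0, 0, 1, 0, 0, 0)) 0 0 (-1)"
    by (rule y_degree_XX; simp)
  \<comment> \<open>The coordinates are left as sums to match \<open>y_degree_mult\<close>. They
    total -1, -1, 1, 1, which gives the l-dependent powers of q in the second sums.\<close>
  have deg_y: "y_degree (XX (1, 0, 0, 0, 0, 0) * (qh (-3) * dlt)) (-1 + 2) (0 + 0) (0 + -2)"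
    "y_degree (XX (0, 1, 0, 0, 0, 0) * (qh (-3) * dlt)) (0 + 2) (-1 + 0) (0 + -2)"
    "y_degree (XX (0, 1, 0, 0, 0, 0) * ymon 0 0 1) (0 + 1) (-1 + 1) (0 + 0)"
    "y_degree (XX (1, 0, 0, 0, 0, 0) * (ymon 0 1 0 * ymon 0 0 1)) (-1 + (1 + 1)) (0 + (0 + 1)) (0 + (-1 + 0))"
    unfolding monom_def[symmetric] by (intro y_degree_mult y_degree_XX y_degree_monom; simp)+
  \<comment> \<open>In the negative sequences the inverse frozen powers of entry 0 cancel against
    \<open>dlt\<close>, leaving y_3 and y_2 y_3. The arguments 5, 5, -1, 0 of \<open>qh\<close> are
    the powers of q at l = 0 in the second sums.\<close>
  have base: "dlt * XX (1, 0, 0, 0, 0, 0) = qh 5 * (XX (1, 0, 0, 0, 0, 0) * (qh (-3) * dlt))"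
    "dlt * XX (0, 1, 0, 0, 0, 0) = qh 5 * (XX (0, 1, 0, 0, 0, 0) * (qh (-3) * dlt))"
    "dlt * monom 0 (0, 1, 0, -1, -1, 0) = qh (-1) * (XX (0, 1, 0, 0, 0, 0) * ymon 0 0 1)"
    "dlt * monom 0 (1, 0, 0, -1, 0, 0) = qh 0 * (XX (1, 0, 0, 0, 0, 0) * (ymon 0 1 0 * ymon 0 0 1))"
    by (simp_all add: torus_eval)
  note formulas =
    chain_iota_formula[OF \<open>n > 0\<close> deg_X deg_y(1) base(1), folded odd_pos_def]
    chain_iota_formula[OF \<open>n > 0\<close> deg(2) deg_y(2) base(2), folded even_pos_def]
    chain_iota_formula[OF \<open>n > 0\<close> deg(1) deg_y(3) base(3), folded even_neg_def]
    chain_iota_formula[OF \<open>n > 0\<close> deg(3) deg_y(4) base(4), folded odd_neg_def]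
  show ?thesis
  proof (intro conjI)
    show "{X (2 * int n + 3), X (2 * int n + 4), X (- (2 * int n)), X (- (2 * int n + 1))} \<subseteq> QCA"
      unfolding X by (simp add: chains_in_QCA)
  qed (unfold y, unfold X x y2 y3 q2_def u_def formulas,
      simp_all add: iota_mult mult.assoc distrib_left add.commute)
qed

end
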